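(* For any finite connected weighted graph with vertex measure $(G,\mu)$ satisfying the curvature-dimension inequality $CD(0,\infty)$ and any natural number $k$ with $2\le k\le|V|$, we have $$h_k(G,\mu)\ge h_2(G,\mu)\ge\frac{(e-1)^2}{40\sqrt2\,e^2}\,\frac{1}{D_G^{nor}\sqrt{D_G^{non}}}\,\frac{\sqrt{\lambda_k(G,\mu)}}{k}.$$
   Context: $G=(V,E,w)$ is an undirected finite connected weighted graph with vertex set $V$, edge set $E$, adjacency relation $\sim$, and symmetric edge weights $w:V\times V\to\mathbb{R}_{\ge 0}$ with $w_{xy}=w_{yx}>0$ if and only if $x\sim y$; $\mu:V\to\mathbb{R}_{>0}$ is a positive vertex measure. The Laplacian is $\Delta f(x)=\frac{1}{\mu(x)}\sum_{y,y\sim x}w_{xy}(f(y)-f(x))$ for $f:V\to\mathbb{R}$. The eigenvalues (numbers $\lambda$ such that $\Delta f+\lambda f=0$ has a nonzero solution $f$) are ordered with multiplicity as $0=\lambda_1(G,\mu)<\lambda_2(G,\mu)\le\cdots\le\lambda_{|V|}(G,\mu)$. $D_G^{non}:=\max_{x\in V}\frac{\sum_{y,y\sim x}w_{xy}}{\mu(x)}$ and $D_G^{nor}:=\max_{x\in V}\max_{y,y\sim x}\frac{\mu(x)}{w_{xy}}$. For nonempty $S\subset V$ let $\phi_{w,\mu}(S):=\frac{|E(S,V\setminus S)|_w}{\mu(S)}$, where $|E(S,V\setminus S)|_w:=\sum_{x\sim y,\,x\in S,\,y\notin S}w_{xy}$ and $\mu(S):=\sum_{x\in S}\mu(x)$.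 The $k$-th Cheeger constant is $h_k(G,\mu):=\min_{S_1,\ldots,S_k}\max_{1\le i\le k}\phi_{w,\mu}(S_i)$, the minimum being over all collections of $k$ nonempty, mutually disjoint subsets $S_1,\ldots,S_k$ of $V$. Define $\Gamma(f,g):=\frac12\{\Delta(fg)-f\Delta g-g\Delta f\}$, $\Gamma_2(f,g):=\frac12\{\Delta\Gamma(f,g)-\Gamma(f,\Delta g)-\Gamma(g,\Delta f)\}$, and $\Gamma_2(f):=\Gamma_2(f,f)$. $(G,\mu)$ satisfies $CD(0,\infty)$ if $\Gamma_2(f)(x)\ge 0$ for all $f:V\to\mathbb{R}$ and all $x\in V$. *)

theory Defs
  imports "HOL-Analysis.Analysis" "HOL-Library.Multiset"
begin

text \<open>
  The vertex set is a finite type \<open>'v\<close>, and \<open>E\<close> is the adjacency relation. Loops are not excluded: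
  they do not affect the Laplacian or the Cheeger constants, and can only enlarge the two
  degree quantities \<open>D_non\<close> and \<open>D_nor\<close>.
\<close>

locale weighted_graph =
  fixes E :: "('v::finite \<times> 'v) set"
    and w :: "'v \<Rightarrow> 'v \<Rightarrow> real"
    and \<mu> :: "'v \<Rightarrow> real"
  assumes sym_E: "sym E"
    and connected: "(x, y) \<in> E\<^sup>*"
    and w_sym: "w x y = w y x"
    and w_nonneg: "0 \<le> w x y"
    and w_pos_iff: "0 < w x y \<longleftrightarrow> (x, y) \<in> E"
    and \<mu>_pos: "0 < \<mu> x"

type_synonym 'v weight = "'v \<Rightarrow> 'v \<Rightarrow> real"

definition laplacian ::
  "('v::finite \<times> 'v) set \<Rightarrow> 'v weight \<Rightarrow> ('v \<Rightarrow> real) \<Rightarrow> ('v \<Rightarrow> real) \<Rightarrow> 'v \<Rightarrow> real" where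
  "laplacian E w \<mu> f x = (1 / \<mu> x) * (\<Sum>y | (x, y) \<in> E. w x y * (f y - f x))"

definition laplacian_eigenvalue ::
  "('v::finite \<times> 'v) set \<Rightarrow> 'v weight \<Rightarrow> ('v \<Rightarrow> real) \<Rightarrow> real \<Rightarrow> bool" where
  "laplacian_eigenvalue E w \<mu> l \<longleftrightarrow>
     (\<exists>f. f \<noteq> (\<lambda>_. 0) \<and> (\<forall>x. laplacian E w \<mu> f x + l * f x = 0))"

text \<open>
  Functions are represented here as vectors in \<open>real ^ 'v\<close>, so that the
  library's \<open>dim\<close> applies to the space of solutions.
\<close>

definition eigenspace ::
  "('v::finite \<times> 'v) set \<Rightarrow> 'v weight \<Rightarrow> ('v \<Rightarrow> real) \<Rightarrow> real \<Rightarrow> (real ^ 'v) set" where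
  "eigenspace E w \<mu> l = {f. \<forall>x. laplacian E w \<mu> (\<lambda>y. f $ y) x + l * f $ x = 0}"

definition spectrum_mset ::
  "('v::finite \<times> 'v) set \<Rightarrow> 'v weight \<Rightarrow> ('v \<Rightarrow> real) \<Rightarrow> real multiset" where
  "spectrum_mset E w \<mu> =
     (\<Sum>l | laplacian_eigenvalue E w \<mu> l. replicate_mset (dim (eigenspace E w \<mu> l)) l)"

text \<open>The eigenvalues are indexed from 1, whereas lists are indexed from 0.\<close>

definition lambda ::
  "('v::finite \<times> 'v) set \<Rightarrow> 'v weight \<Rightarrow> ('v \<Rightarrow> real) \<Rightarrow> nat \<Rightarrow> real" where
  "lambda E w \<mu> k = sorted_list_of_multiset (spectrum_mset E w \<mu>) ! (k - 1)"

definition D_non ::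
  "('v::finite \<times> 'v) set \<Rightarrow> 'v weight \<Rightarrow> ('v \<Rightarrow> real) \<Rightarrow> real" where
  "D_non E w \<mu> = (MAX x. (\<Sum>y | (x, y) \<in> E. w x y) / \<mu> x)"

text \<open>
  In a connected graph with at least two vertices every vertex has a neighbour,
  so the inner maximum is over a nonempty set.
\<close>

definition D_nor ::
  "('v::finite \<times> 'v) set \<Rightarrow> 'v weight \<Rightarrow> ('v \<Rightarrow> real) \<Rightarrow> real" where
  "D_nor E w \<mu> = (MAX x. MAX y\<in>{y. (x, y) \<in> E}. \<mu> x / w x y)"

definition boundary_weight ::
  "('v::finite \<times> 'v) set \<Rightarrow> 'v weight \<Rightarrow> 'v set \<Rightarrow> real" where
  "boundary_weight E w S = (\<Sum>(x, y) | (x, y) \<in> E \<and> x \<in> S \<and> y \<notin> S. w x y)"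

definition expansion ::
  "('v::finite \<times> 'v) set \<Rightarrow> 'v weight \<Rightarrow> ('v \<Rightarrow> real) \<Rightarrow> 'v set \<Rightarrow> real" where
  "expansion E w \<mu> S = boundary_weight E w S / (\<Sum>x\<in>S. \<mu> x)"

text \<open>
  There are infinitely many maps \<open>S\<close> on \<open>nat\<close>, but the set of values being minimised is finite,
  since \<open>expansion\<close> takes only finitely many values. It is nonempty for \<open>1 \<le> k \<le> CARD('v)\<close>.
\<close>

definition cheeger ::
  "('v::finite \<times> 'v) set \<Rightarrow> 'v weight \<Rightarrow> ('v \<Rightarrow> real) \<Rightarrow> nat \<Rightarrow> real" where
  "cheeger E w \<mu> k =
     Min {(MAX i\<in>{1..k}. expansion E w \<mu> (S i)) | S :: nat \<Rightarrow> 'v set.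
            (\<forall>i\<in>{1..k}. S i \<noteq> {}) \<and> disjoint_family_on S {1..k}}"

definition Gam ::
  "('v::finite \<times> 'v) set \<Rightarrow> 'v weight \<Rightarrow> ('v \<Rightarrow> real) \<Rightarrow>
     ('v \<Rightarrow> real) \<Rightarrow> ('v \<Rightarrow> real) \<Rightarrow> 'v \<Rightarrow> real" where
  "Gam E w \<mu> f g x =
     (1 / 2) * (laplacian E w \<mu> (\<lambda>z. f z * g z) x
                - f x * laplacian E w \<mu> g x - g x * laplacian E w \<mu> f x)"

definition Gam2 ::
  "('v::finite \<times> 'v) set \<Rightarrow> 'v weight \<Rightarrow> ('v \<Rightarrow> real) \<Rightarrow>
     ('v \<Rightarrow> real) \<Rightarrow> ('v \<Rightarrow> real) \<Rightarrow> 'v \<Rightarrow> real" where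
  "Gam2 E w \<mu> f g x =
     (1 / 2) * (laplacian E w \<mu> (Gam E w \<mu> f g) x
                - Gam E w \<mu> f (laplacian E w \<mu> g) x - Gam E w \<mu> g (laplacian E w \<mu> f) x)"

definition CD_zero_infinity ::
  "('v::finite \<times> 'v) set \<Rightarrow> 'v weight \<Rightarrow> ('v \<Rightarrow> real) \<Rightarrow> bool" where
  "CD_zero_infinity E w \<mu> \<longleftrightarrow> (\<forall>f x. 0 \<le> Gam2 E w \<mu> f f x)"

end

theory Submission
  imports Defs
begin

text \<open>
  Two inequalities about the spectral gap \<open>l\<close>, the least value of the Rayleigh quotient
  \<open>energy g g / ip g g\<close> on functions of mean zero, are played against each other. Write
  \<open>h\<close> for the second Cheeger constant.

  The curvature condition makes \<open>h\<close> large in terms of \<open>l\<close> (lemma \<open>buser\<close>):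
  \<open>(1 - 1/e) * sqrt l \<le> 2 * sqrt D_nor * h\<close>. Nonnegative curvature says that
  \<open>s \<mapsto> P\<^sub>s ((P\<^sub>t\<^sub>-\<^sub>s g)\<^sup>2)\<close> is convex, where \<open>P\<close> is the heat semigroup, so the heat flow of an
  indicator function has gradient of order \<open>1 / sqrt t\<close> (lemma \<open>gradient_estimate\<close>). Hence the
  mass that heat carries out of a set \<open>S\<close> up to time \<open>t\<close> is at most \<open>sqrt (D_nor * t)\<close> times the
  boundary of \<open>S\<close>, while the spectral gap forces a fixed proportion of the mass out of \<open>S\<close>
  by time \<open>t = 1 / l\<close>.

  Conversely \<open>h\<close> is small in terms of \<open>l\<close>, and the more so the larger the \<open>k\<close>-th eigenvalue is
  (lemma \<open>improved_cheeger\<close>): \<open>h \<le> 10 * sqrt 2 * k * sqrt (D_non / \<lambda>\<^sub>k) * l\<close>. Let \<open>f\<close> be the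
  positive part of an eigenfunction for \<open>l\<close>. If \<open>f\<close> were far from every function with at most
  \<open>2 * k\<close> steps, then cutting its range into \<open>2 * k\<close> intervals would give \<open>k\<close> disjointly supported
  functions with small Rayleigh quotient, and by the min-max principle \<open>\<lambda>\<^sub>k\<close> would be small. So \<open>f\<close>
  is close to a step function; integrating the distance from a point of the range to the
  nearest step yields a function of \<open>f\<close> comparable with \<open>f\<^sup>2\<close> but with much smaller total
  variation, and by the coarea inequality one of its level sets has small expansion.

  Eliminating \<open>l\<close> bounds \<open>h\<close> by a multiple of \<open>h\<^sup>2\<close>; since connectedness gives \<open>h > 0\<close>, one
  factor \<open>h\<close> cancels.
\<close>

section \<open>Self-adjoint operators and their eigenvalue counts\<close>

text \<open>
  A minimiser of the Rayleigh quotient on the unit sphere of \<open>V\<close> exists by compactness. The first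
  variation at a minimiser \<open>v\<close> in the direction \<open>T v - c v\<close>, which lies in \<open>V\<close> by invariance, must
  vanish, so \<open>v\<close> is an eigenvector.
\<close>

lemma rayleigh_minimizer:
  fixes T :: "'a::euclidean_space \<Rightarrow> 'a"
  assumes T: "linear T" and sa: "\<And>x y. T x \<bullet> y = x \<bullet> T y"
    and V: "subspace V" and inv: "\<And>x. x \<in> V \<Longrightarrow> T x \<in> V" and nz: "\<exists>x\<in>V. x \<noteq> 0"
  obtains c v where "v \<in> V" "v \<noteq> 0" "T v = c *\<^sub>R v" "\<And>x. x \<in> V \<Longrightarrow> c * (x \<bullet> x) \<le> T x \<bullet> x"
proof -
  let ?K = "sphere 0 1 \<inter> V"
  have cpt: "compact ?K"
    using V closed_subspace compact_Int_closed compact_sphere by blast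
  obtain x0 where x0: "x0 \<in> V" "x0 \<noteq> 0" using nz by blast
  then have "(1 / norm x0) *\<^sub>R x0 \<in> ?K"
    using V by (auto simp: subspace_scale)
  then have ne: "?K \<noteq> {}" by blast
  have cont: "continuous_on ?K (\<lambda>x. T x \<bullet> x)"
    using T by (intro continuous_intros linear_continuous_on linear_conv_bounded_linear[THEN iffD1])
  obtain v where v: "v \<in> ?K" and vmin: "\<And>y. y \<in> ?K \<Longrightarrow> T v \<bullet> v \<le> T y \<bullet> y"
    using continuous_attains_inf[OF cpt ne cont] by blast
  define c where "c = T v \<bullet> v"
  have vv: "v \<bullet> v = 1" using v by (simp add: dot_square_norm)
  have lower: "c * (x \<bullet> x) \<le> T x \<bullet> x" if x: "x \<in> V" for x
  proof (cases "x = 0")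
    case True
    then show ?thesis by simp
  next
    case False
    have "(1 / norm x) *\<^sub>R x \<in> ?K" using False V x by (auto simp: subspace_scale)
    from vmin[OF this] have "c \<le> (T x \<bullet> x) / (norm x)\<^sup>2"
      using T by (simp add: c_def linear_scale power2_eq_square)
    then show ?thesis using False by (simp add: field_simps dot_square_norm)
  qed
  define z where "z = T v - c *\<^sub>R v"
  have zV: "z \<in> V" unfolding z_def using v V inv by (simp add: subspace_diff subspace_scale)
  define q where "q = T z \<bullet> z - c * (z \<bullet> z)"
  have zero: "z = 0"
  proof (rule ccontr)
    assume nz: "z \<noteq> 0"
    have expand: "0 \<le> 2 * t * (z \<bullet> z) + t\<^sup>2 * q" for t :: real
    proof -
      have "v + t *\<^sub>R z \<in> V" using v zV V by (simp add: subspace_add subspace_scale)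
      from lower[OF this]
      have "0 \<le> T (v + t *\<^sub>R z) \<bullet> (v + t *\<^sub>R z) - c * ((v + t *\<^sub>R z) \<bullet> (v + t *\<^sub>R z))" by simp
      also have "\<dots> = 2 * t * ((T v - c *\<^sub>R v) \<bullet> z) + t\<^sup>2 * q"
      proof -
        have "T z \<bullet> v = T v \<bullet> z" by (metis sa inner_commute)
        then show ?thesis
          using T vv
          by (simp add: linear_add linear_scale inner_simps q_def c_def power2_eq_square
              algebra_simps inner_commute[of z v])
      qed
      finally show ?thesis by (simp add: z_def)
    qed
    have pos: "0 < z \<bullet> z" using nz by simp
    show False
    proof (cases "q \<le> 0")
      case True
      have "0 \<le> - 2 * (z \<bullet> z) + q" using expand[of "-1"] by simp
      then show False using True pos by linarith
    next
      case False
      \<comment> \<open>The minimum of the quadratic polynomial in \<open>t\<close>.\<close>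
      have "0 \<le> 2 * (- (z \<bullet> z) / q) * (z \<bullet> z) + (- (z \<bullet> z) / q)\<^sup>2 * q" by (rule expand)
      also have "\<dots> = - ((z \<bullet> z)\<^sup>2 / q)" using False by (simp add: field_simps power2_eq_square)
      finally show False using False pos by (simp add: field_simps)
    qed
  qed
  show ?thesis
  proof (rule that[of v c])
    show "v \<in> V" "v \<noteq> 0" using v by auto
    show "T v = c *\<^sub>R v" using zero by (simp add: z_def)
  qed (rule lower)
qed

text \<open>
  Eigenvectors for distinct eigenvalues are orthogonal, hence linearly independent.
\<close>

lemma selfadjoint_finite_eigenvalues:
  fixes T :: "'a::euclidean_space \<Rightarrow> 'a"
  assumes sa: "\<And>x y. T x \<bullet> y = x \<bullet> T y"
  shows "finite {l. \<exists>v. v \<noteq> 0 \<and> T v = l *\<^sub>R v}" (is "finite ?L")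
proof -
  define ev where "ev l = (SOME v. v \<noteq> 0 \<and> T v = l *\<^sub>R v)" for l
  have ev: "ev l \<noteq> 0" "T (ev l) = l *\<^sub>R ev l" if "l \<in> ?L" for l
    using someI_ex[of "\<lambda>v. v \<noteq> 0 \<and> T v = l *\<^sub>R v"] that by (auto simp: ev_def)
  have orth: "ev l \<bullet> ev m = 0" if "l \<in> ?L" "m \<in> ?L" "l \<noteq> m" for l m
  proof -
    have "l * (ev l \<bullet> ev m) = m * (ev l \<bullet> ev m)"
      using sa[of "ev l" "ev m"] ev that by simp
    then show ?thesis using that by simp
  qed
  have inj: "inj_on ev ?L"
    by (rule inj_onI) (metis (no_types, lifting) ev(1) orth inner_eq_zero_iff)
  have "pairwise orthogonal (ev ` ?L)"
    unfolding pairwise_def orthogonal_def using orth by blast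
  moreover have "0 \<notin> ev ` ?L" using ev(1) by (metis (no_types, lifting) imageE)
  ultimately have "independent (ev ` ?L)" by (rule pairwise_orthogonal_independent)
  then have "finite (ev ` ?L)" by (rule independent_imp_finite)
  then show ?thesis using inj finite_imageD by blast
qed

lemma dim_UN_le:
  fixes S :: "'i \<Rightarrow> 'a::euclidean_space set"
  assumes "finite I"
  shows "dim (\<Union>i\<in>I. S i) \<le> (\<Sum>i\<in>I. dim (S i))"
  using assms
proof (induction I rule: finite_induct)
  case (insert i I)
  have "dim (S i \<union> (\<Union>i\<in>I. S i)) \<le> dim (S i) + dim (\<Union>i\<in>I. S i)"
  proof -
    have "dim (S i \<union> (\<Union>i\<in>I. S i)) = dim (span (S i \<union> (\<Union>i\<in>I. S i)))" by simp
    also have "span (S i \<union> (\<Union>i\<in>I. S i)) = {x + y |x y. x \<in> span (S i) \<and> y \<in> span (\<Union>i\<in>I. S i)}"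
      by (subst span_Un) blast
    also have "dim \<dots> \<le> dim (S i) + dim (\<Union>i\<in>I. S i)"
      using dim_sums_Int[of "span (S i)" "span (\<Union>i\<in>I. S i)"] by simp
    finally show ?thesis .
  qed
  then show ?case using insert by simp
qed simp

text \<open>
  The min-max principle, phrased as a count of eigenvalues so that it needs no list of all of them.
  If the eigenspaces for eigenvalues up to \<open>R\<close> spanned a space \<open>U\<close> of dimension less than
  \<open>dim W\<close>, then \<open>W\<close> would meet the orthogonal complement of \<open>U\<close>. The least eigenvalue on that
  invariant complement would then be at most \<open>R\<close>, with an eigenvector in both \<open>U\<close> and its
  complement.
\<close>

lemma minmax_eigenvalue_count:
  fixes T :: "'a::euclidean_space \<Rightarrow> 'a"
  assumes T: "linear T" and sa: "\<And>x y. T x \<bullet> y = x \<bullet> T y"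
    and W: "subspace W" and bd: "\<And>x. x \<in> W \<Longrightarrow> T x \<bullet> x \<le> R * (x \<bullet> x)"
  shows "dim W \<le> (\<Sum>l | l \<le> R \<and> (\<exists>v. v \<noteq> 0 \<and> T v = l *\<^sub>R v). dim {v. T v = l *\<^sub>R v})"
    (is "_ \<le> (\<Sum>l\<in>?L. dim (?e l))")
proof (rule ccontr)
  assume lt: "\<not> dim W \<le> (\<Sum>l\<in>?L. dim (?e l))"
  have "finite ?L" by (rule finite_subset[OF _ selfadjoint_finite_eigenvalues[OF sa]]) auto
  define U where "U = span (\<Union>l\<in>?L. ?e l)"
  define V where "V = {y. \<forall>x\<in>U. orthogonal x y}"
  have dU: "dim U < dim W"
    using dim_UN_le[OF \<open>finite ?L\<close>, of ?e] lt by (simp add: U_def)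
  have sU: "subspace U" by (simp add: U_def)
  have sV: "subspace V" unfolding V_def
    by (auto simp: subspace_def orthogonal_def inner_simps)
  have TU: "T x \<in> U" if "x \<in> U" for x
    using that unfolding U_def
  proof (induction rule: span_induct_alt)
    case base
    then show ?case using linear_0[OF T] by (simp add: span_zero)
  next
    case (step c x y)
    then obtain l where l: "l \<in> ?L" "T x = l *\<^sub>R x" by auto
    have "T (c *\<^sub>R x + y) = (c * l) *\<^sub>R x + T y" using T l by (simp add: linear_add linear_scale)
    then show ?case using step by (simp add: span_add span_scale span_base)
  qed
  have TV: "T y \<in> V" if "y \<in> V" for y
    using that TU unfolding V_def orthogonal_def by (auto simp: sa[symmetric])
  have dV: "dim V + dim U = DIM('a)"
    using dim_subspace_orthogonal_to_vectors[OF sU subspace_UNIV] by (simp add: V_def)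
  have "dim (W \<inter> V) \<noteq> 0"
  proof
    assume "dim (W \<inter> V) = 0"
    then have "dim {x + y |x y. x \<in> W \<and> y \<in> V} = dim W + dim V"
      using dim_sums_Int[OF W sV] by linarith
    moreover have "dim {x + y |x y. x \<in> W \<and> y \<in> V} \<le> DIM('a)" by (rule dim_subset_UNIV)
    ultimately show False using dV dU by linarith
  qed
  then obtain x where x: "x \<in> W" "x \<in> V" "x \<noteq> 0" by (auto simp: dim_eq_0)
  obtain c v where v: "v \<in> V" "v \<noteq> 0" "T v = c *\<^sub>R v"
    and lower: "\<And>x. x \<in> V \<Longrightarrow> c * (x \<bullet> x) \<le> T x \<bullet> x"
    using rayleigh_minimizer[OF T sa sV TV] x by blast
  have "c * (x \<bullet> x) \<le> R * (x \<bullet> x)" using lower[OF x(2)] bd[OF x(1)] by linarith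
  then have "c \<le> R" using x(3) by simp
  then have "v \<in> U" unfolding U_def using v by (intro span_base) auto
  then have "orthogonal v v" using v unfolding V_def by blast
  then show False using v by (simp add: orthogonal_def)
qed

lemma nth_sorted_list_of_multiset_le:
  fixes M :: "'a::linorder multiset"
  assumes "1 \<le> k" and "k \<le> size (filter_mset (\<lambda>l. l \<le> R) M)"
  shows "sorted_list_of_multiset M ! (k - 1) \<le> R"
proof (rule ccontr)
  let ?xs = "sorted_list_of_multiset M"
  assume gt: "\<not> ?xs ! (k - 1) \<le> R"
  have len: "length (filter (\<lambda>l. l \<le> R) ?xs) = size (filter_mset (\<lambda>l. l \<le> R) M)"
    by (metis mset_filter mset_sorted_list_of_multiset size_mset)
  have "filter (\<lambda>l. l \<le> R) (drop (k - 1) ?xs) = []"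
  proof -
    have "R < x" if x: "x \<in> set (drop (k - 1) ?xs)" for x
    proof -
      obtain i where i: "i < length (drop (k - 1) ?xs)" "x = drop (k - 1) ?xs ! i"
        using x by (auto simp: in_set_conv_nth)
      then have "?xs ! (k - 1) \<le> x"
        using sorted_sorted_list_of_multiset[of M] by (auto intro!: sorted_nth_mono)
      then show ?thesis using gt by simp
    qed
    then show ?thesis by (force simp: filter_empty_conv)
  qed
  then have "filter (\<lambda>l. l \<le> R) ?xs = filter (\<lambda>l. l \<le> R) (take (k - 1) ?xs)"
    by (metis append_Nil2 append_take_drop_id filter_append)
  then have "length (filter (\<lambda>l. l \<le> R) ?xs) \<le> k - 1"
    by (metis length_filter_le length_take min.bounded_iff)
  then show False using assms len by linarith
qed

lemma size_filter_sum_replicate_mset: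
  assumes "finite A"
  shows "size (filter_mset P (\<Sum>l\<in>A. replicate_mset (d l) l)) = (\<Sum>l | l \<in> A \<and> P l. d l)"
  using assms
proof (induction A rule: finite_induct)
  case (insert a A)
  have "{l. l \<in> insert a A \<and> P l} = (if P a then insert a {l. l \<in> A \<and> P l} else {l. l \<in> A \<and> P l})"
    by auto
  moreover have "filter_mset P (replicate_mset n a) = (if P a then replicate_mset n a else {#})" for n
    by (induction n) auto
  ultimately show ?case using insert by auto
qed simp

section \<open>The distance to a finite set of thresholds\<close>

definition proj :: "real \<Rightarrow> real \<Rightarrow> real \<Rightarrow> real" where
  "proj a b s = max a (min b s)"

text \<open>
  For \<open>s\<close> between consecutive thresholds \<open>a\<close> and \<open>b\<close> this is the distance from \<open>s\<close> to the nearest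
  threshold. Extending it by zero lets the bumps of all intervals simply be added.
\<close>

definition bump :: "real \<Rightarrow> real \<Rightarrow> real \<Rightarrow> real" where
  "bump a b s = max 0 (min (s - a) (b - s))"

text \<open>
  The integral of \<open>bump a b\<close> from \<open>a\<close> to \<open>s\<close>, in closed form.
\<close>

definition bump_area :: "real \<Rightarrow> real \<Rightarrow> real \<Rightarrow> real" where
  "bump_area a b s =
    (let p = proj a b s
     in if p \<le> (a + b) / 2 then (p - a)\<^sup>2 / 2 else (b - a)\<^sup>2 / 4 - (b - p)\<^sup>2 / 2)"

lemma proj_mono: "s \<le> s' \<Longrightarrow> proj a b s \<le> proj a b s'"
  by (auto simp: proj_def max_def min_def)

lemma proj_add: "a \<le> b \<Longrightarrow> b \<le> c \<Longrightarrow> proj a b s + proj b c s = proj a c s + b"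
  by (auto simp: proj_def max_def min_def)

lemma sum_proj:
  assumes "mono t"
  shows "(\<Sum>i<m. proj (t i) (t (Suc i)) s - t i) = proj (t 0) (t m) s - t 0"
proof (induction m)
  case 0
  then show ?case by (simp add: proj_def)
next
  case (Suc m)
  have "proj (t 0) (t m) s + proj (t m) (t (Suc m)) s = proj (t 0) (t (Suc m)) s + t m"
    using assms by (intro proj_add) (auto simp: mono_def)
  then show ?case using Suc by simp
qed

lemma bump_nonneg: "0 \<le> bump a b s"
  by (simp add: bump_def)

lemma bump_lipschitz:
  assumes "a \<le> b"
  shows "\<bar>bump a b s - bump a b s'\<bar> \<le> \<bar>proj a b s - proj a b s'\<bar>"
  using assms by (auto simp: bump_def proj_def max_def min_def abs_if)

lemma bump_proj_eq:
  assumes "a \<le> b"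
  shows "bump a b s = (let p = proj a b s in if p \<le> (a + b) / 2 then p - a else b - p)"
  using assms by (auto simp: bump_def proj_def max_def min_def Let_def field_simps)

lemma proj_bounds: "a \<le> b \<Longrightarrow> a \<le> proj a b s \<and> proj a b s \<le> b"
  by (auto simp: proj_def)

lemma bump_area_lower:
  assumes "a \<le> b"
  shows "(proj a b s - a)\<^sup>2 / 4 \<le> bump_area a b s"
proof -
  define p where "p = proj a b s"
  have p: "a \<le> p" "p \<le> b" using proj_bounds[OF assms] by (auto simp: p_def)
  show ?thesis
  proof (cases "p \<le> (a + b) / 2")
    case True
    then show ?thesis by (simp add: bump_area_def p_def Let_def)
  next
    case False
    define c where "c = b - p"
    have c: "0 \<le> c" "2 * c \<le> b - a" using p False by (auto simp: c_def)
    have "(b - a)\<^sup>2 / 4 - c\<^sup>2 / 2 - (b - a - c)\<^sup>2 / 4 = c * (2 * (b - a) - 3 * c) / 4"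
      by (simp add: power2_eq_square field_simps)
    also have "\<dots> \<ge> 0" using c by simp
    finally show ?thesis using False
      by (simp add: bump_area_def p_def[symmetric] Let_def c_def algebra_simps)
  qed
qed

lemma bump_area_mono:
  assumes ab: "a \<le> b" and ss: "s \<le> s'"
  shows "bump_area a b s \<le> bump_area a b s'"
proof -
  define p q where "p = proj a b s" and "q = proj a b s'"
  have pq: "a \<le> p" "p \<le> q" "q \<le> b"
    using proj_bounds[OF ab] proj_mono[OF ss] by (auto simp: p_def q_def)
  consider "q \<le> (a + b) / 2" | "p \<le> (a + b) / 2" "q > (a + b) / 2" | "p > (a + b) / 2"
    using pq by linarith
  then show ?thesis
  proof cases
    case 1
    have "(p - a)\<^sup>2 \<le> (q - a)\<^sup>2" using pq by (intro power_mono) auto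
    then show ?thesis using 1 pq by (simp add: bump_area_def p_def[symmetric] q_def[symmetric] Let_def)
  next
    case 2
    have "(p - a)\<^sup>2 \<le> ((b - a) / 2)\<^sup>2" "(b - q)\<^sup>2 \<le> ((b - a) / 2)\<^sup>2"
      using pq 2 by (auto intro!: power_mono)
    then show ?thesis using 2 pq
      by (simp add: bump_area_def p_def[symmetric] q_def[symmetric] Let_def power_divide)
  next
    case 3
    have "(b - q)\<^sup>2 \<le> (b - p)\<^sup>2" using pq by (intro power_mono) auto
    then show ?thesis using 3 pq by (simp add: bump_area_def p_def[symmetric] q_def[symmetric] Let_def)
  qed
qed

text \<open>
  On an interval of length \<open>l\<close>, a function with Lipschitz constant 1 and values \<open>p\<close>, \<open>q\<close> at the ends
  has integral at most \<open>l * (p + q) / 2 + l\<^sup>2 / 4\<close>, the extremal case being a tent. Only the length of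
  the part inside the interval from \<open>a\<close> to \<open>b\<close> is charged, so that the estimates for adjacent
  intervals add up.
\<close>

lemma bump_area_increment:
  assumes ab: "a \<le> b" and ss: "s \<le> s'"
  defines "l \<equiv> proj a b s' - proj a b s"
  shows "bump_area a b s' - bump_area a b s \<le> l * (bump a b s + bump a b s') / 2 + l\<^sup>2 / 4"
proof -
  define p q where "p = proj a b s" and "q = proj a b s'"
  have pq: "a \<le> p" "p \<le> q" "q \<le> b"
    using proj_bounds[OF ab] proj_mono[OF ss] by (auto simp: p_def q_def)
  note defs = bump_area_def bump_proj_eq[OF ab] l_def p_def[symmetric] q_def[symmetric] Let_def
  consider "q \<le> (a + b) / 2" | "p \<le> (a + b) / 2" "q > (a + b) / 2" | "p > (a + b) / 2"
    using pq by linarith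
  then show ?thesis
  proof cases
    case 1
    have "(q - a)\<^sup>2 / 2 - (p - a)\<^sup>2 / 2 = (q - p) * ((p - a) + (q - a)) / 2"
      by (simp add: power2_eq_square field_simps)
    then have "(q - a)\<^sup>2 / 2 - (p - a)\<^sup>2 / 2 \<le> (q - p) * ((p - a) + (q - a)) / 2 + (q - p)\<^sup>2 / 4"
      using zero_le_power2[of "q - p"] by linarith
    then show ?thesis using 1 pq by (simp add: defs)
  next
    case 2
    have "(q - p) * ((p - a) + (b - q)) / 2 + (q - p)\<^sup>2 / 4
      - ((b - a)\<^sup>2 / 4 - (b - q)\<^sup>2 / 2 - (p - a)\<^sup>2 / 2) = ((p - a) - (b - q))\<^sup>2 / 4"
      by (simp add: power2_eq_square field_simps)
    moreover have "\<dots> \<ge> 0" by simp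
    ultimately have "(b - a)\<^sup>2 / 4 - (b - q)\<^sup>2 / 2 - (p - a)\<^sup>2 / 2
        \<le> (q - p) * ((p - a) + (b - q)) / 2 + (q - p)\<^sup>2 / 4" by linarith
    then show ?thesis using 2 pq by (simp add: defs)
  next
    case 3
    have "(b - p)\<^sup>2 / 2 - (b - q)\<^sup>2 / 2 = (q - p) * ((b - p) + (b - q)) / 2"
      by (simp add: power2_eq_square field_simps)
    then have "(b - p)\<^sup>2 / 2 - (b - q)\<^sup>2 / 2 \<le> (q - p) * ((b - p) + (b - q)) / 2 + (q - p)\<^sup>2 / 4"
      using zero_le_power2[of "q - p"] by linarith
    then show ?thesis using 3 pq by (simp add: defs)
  qed
qed

lemma bump_disjoint:
  assumes "mono t" "i \<noteq> j"
  shows "bump (t i) (t (Suc i)) s * bump (t j) (t (Suc j)) s = 0"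
proof -
  have *: "bump (t i) (t (Suc i)) s * bump (t j) (t (Suc j)) s = 0" if "i < j" for i j
  proof -
    have "t (Suc i) \<le> t j" using assms that by (auto simp: mono_def)
    then show ?thesis by (auto simp: bump_def max_def min_def)
  qed
  show ?thesis using *[of i j] *[of j i] assms(2) by (metis linorder_neqE_nat mult.commute)
qed

lemma sum_power2_le_power2_sum:
  fixes a :: "'i \<Rightarrow> real"
  assumes "finite I" "\<And>i. i \<in> I \<Longrightarrow> 0 \<le> a i"
  shows "(\<Sum>i\<in>I. (a i)\<^sup>2) \<le> (\<Sum>i\<in>I. a i)\<^sup>2"
  using assms
proof (induction I rule: finite_induct)
  case (insert i I)
  have "0 \<le> a i * (\<Sum>i\<in>I. a i)" using insert by (simp add: sum_nonneg)
  then show ?case using insert by (simp add: power2_sum)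
qed simp

lemma sum_proj_diff_le:
  assumes t: "mono t" and ss: "s \<le> s'"
  shows "(\<Sum>i<m. proj (t i) (t (Suc i)) s' - proj (t i) (t (Suc i)) s) \<le> s' - s"
proof -
  have "(\<Sum>i<m. proj (t i) (t (Suc i)) s' - proj (t i) (t (Suc i)) s)
    = (\<Sum>i<m. proj (t i) (t (Suc i)) s' - t i) - (\<Sum>i<m. proj (t i) (t (Suc i)) s - t i)"
    unfolding sum_subtractf[symmetric] by simp
  also have "\<dots> = proj (t 0) (t m) s' - proj (t 0) (t m) s"
    unfolding sum_proj[OF t] by simp
  also have "\<dots> \<le> s' - s" using ss by (auto simp: proj_def max_def min_def)
  finally show ?thesis .
qed

lemma sum_proj_diff_power2_le:
  assumes t: "mono t" and ss: "s \<le> s'"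
  shows "(\<Sum>i<m. (proj (t i) (t (Suc i)) s' - proj (t i) (t (Suc i)) s)\<^sup>2) \<le> (s' - s)\<^sup>2"
proof -
  have nonneg: "0 \<le> proj (t i) (t (Suc i)) s' - proj (t i) (t (Suc i)) s" for i
    using proj_mono[OF ss] by simp
  have "(\<Sum>i<m. (proj (t i) (t (Suc i)) s' - proj (t i) (t (Suc i)) s)\<^sup>2)
    \<le> (\<Sum>i<m. proj (t i) (t (Suc i)) s' - proj (t i) (t (Suc i)) s)\<^sup>2"
    by (rule sum_power2_le_power2_sum) (use nonneg in auto)
  also have "\<dots> \<le> (s' - s)\<^sup>2"
    by (intro power_mono sum_proj_diff_le[OF t ss] sum_nonneg nonneg)
  finally show ?thesis .
qed

text \<open>
  Each bump varies by at most the length of its own piece of the segment from \<open>s\<close> to \<open>s'\<close>, and the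
  squares of the lengths of the pieces add up to at most the square of the total length.
\<close>

lemma sum_bump_diff_power2_le:
  assumes t: "mono t"
  shows "(\<Sum>i<m. (bump (t i) (t (Suc i)) s - bump (t i) (t (Suc i)) s')\<^sup>2) \<le> (s - s')\<^sup>2"
proof -
  have *: "(\<Sum>i<m. (bump (t i) (t (Suc i)) s - bump (t i) (t (Suc i)) s')\<^sup>2) \<le> (s - s')\<^sup>2"
    if "s' \<le> s" for s s'
  proof -
    have "(bump (t i) (t (Suc i)) s - bump (t i) (t (Suc i)) s')\<^sup>2
      \<le> (proj (t i) (t (Suc i)) s - proj (t i) (t (Suc i)) s')\<^sup>2" for i
      using bump_lipschitz[of "t i" "t (Suc i)" s s'] t
      by (simp add: abs_le_square_iff mono_def)
    then show ?thesis by (rule order_trans[OF sum_mono sum_proj_diff_power2_le[OF t that]])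
  qed
  show ?thesis
  proof (cases "s' \<le> s")
    case False
    have "(\<Sum>i<m. (bump (t i) (t (Suc i)) s - bump (t i) (t (Suc i)) s')\<^sup>2)
      = (\<Sum>i<m. (bump (t i) (t (Suc i)) s' - bump (t i) (t (Suc i)) s)\<^sup>2)"
      by (intro sum.cong refl power2_commute)
    also have "\<dots> \<le> (s' - s)\<^sup>2" by (rule *) (use False in linarith)
    finally show ?thesis by (simp only: power2_commute[of s s'])
  qed (rule *)
qed

lemma sum_bump_area_increment:
  fixes t :: "nat \<Rightarrow> real" and m :: nat
  assumes t: "mono t" and ss: "s \<le> s'"
  defines "H \<equiv> \<lambda>s. \<Sum>i<m. bump_area (t i) (t (Suc i)) s"
    and "d \<equiv> \<lambda>s. \<Sum>i<m. bump (t i) (t (Suc i)) s"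
  shows "H s \<le> H s'" and "H s' - H s \<le> (s' - s) * (d s + d s') / 2 + (s' - s)\<^sup>2 / 4"
proof -
  have ti: "t i \<le> t (Suc i)" for i using t by (simp add: mono_def)
  show "H s \<le> H s'" unfolding H_def by (intro sum_mono bump_area_mono ti ss)
  define l where "l i = proj (t i) (t (Suc i)) s' - proj (t i) (t (Suc i)) s" for i
  have l0: "0 \<le> l i" for i using proj_mono[OF ss] by (simp add: l_def)
  have l1: "l i \<le> s' - s" for i using ss by (auto simp: l_def proj_def max_def min_def)
  have "H s' - H s = (\<Sum>i<m. bump_area (t i) (t (Suc i)) s' - bump_area (t i) (t (Suc i)) s)"
    by (simp add: H_def sum_subtractf)
  also have "\<dots> \<le> (\<Sum>i<m. l i * (bump (t i) (t (Suc i)) s + bump (t i) (t (Suc i)) s') / 2 + (l i)\<^sup>2 / 4)"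
    unfolding l_def by (intro sum_mono bump_area_increment ti ss)
  also have "\<dots> \<le> (\<Sum>i<m. (s' - s) * (bump (t i) (t (Suc i)) s + bump (t i) (t (Suc i)) s') / 2 + (l i)\<^sup>2 / 4)"
    by (intro sum_mono add_right_mono divide_right_mono mult_right_mono l1 add_nonneg_nonneg bump_nonneg) simp
  also have "\<dots> = (s' - s) * (d s + d s') / 2 + (\<Sum>i<m. (l i)\<^sup>2) / 4"
    by (simp add: d_def sum.distrib sum_distrib_left sum_divide_distrib distrib_left add_divide_distrib)
  also have "\<dots> \<le> (s' - s) * (d s + d s') / 2 + (s' - s)\<^sup>2 / 4"
    using sum_proj_diff_power2_le[OF t ss, of m] by (simp add: l_def)
  finally show "H s' - H s \<le> (s' - s) * (d s + d s') / 2 + (s' - s)\<^sup>2 / 4" .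
qed

text \<open>
  Each piece contributes a quarter of the square of its length. By Cauchy-Schwarz the sum is smallest
  when the \<open>m\<close> pieces are of equal length.
\<close>

lemma sum_bump_area_lower:
  assumes t: "mono t" and s: "t 0 \<le> s" "s \<le> t m"
  shows "(s - t 0)\<^sup>2 \<le> 4 * real m * (\<Sum>i<m. bump_area (t i) (t (Suc i)) s)"
proof -
  have ti: "t i \<le> t (Suc i)" for i using t by (simp add: mono_def)
  have "s - t 0 = (\<Sum>i<m. proj (t i) (t (Suc i)) s - t i)"
    unfolding sum_proj[OF t] using s by (simp add: proj_def)
  then have "(s - t 0)\<^sup>2 \<le> (\<Sum>i<m. (proj (t i) (t (Suc i)) s - t i)\<^sup>2) * real m"
    using sum_squared_le_sum_of_squares[of "\<lambda>i. proj (t i) (t (Suc i)) s - t i" "{..<m}"] by simp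
  also have "(\<Sum>i<m. (proj (t i) (t (Suc i)) s - t i)\<^sup>2)
      \<le> (\<Sum>i<m. 4 * bump_area (t i) (t (Suc i)) s)"
  proof (rule sum_mono)
    fix i
    show "(proj (t i) (t (Suc i)) s - t i)\<^sup>2 \<le> 4 * bump_area (t i) (t (Suc i)) s"
      using bump_area_lower[OF ti[of i], of s] by linarith
  qed
  finally show ?thesis by (simp add: sum_distrib_left[symmetric] mult_ac mult_right_mono)
qed

lemma disjoint_supp_card_le_1:
  fixes u :: "'i \<Rightarrow> real"
  assumes "finite I" "\<And>i j. i \<in> I \<Longrightarrow> j \<in> I \<Longrightarrow> i \<noteq> j \<Longrightarrow> u i * u j = 0"
  shows "card {i \<in> I. u i \<noteq> 0} \<le> 1"
proof -
  have "a = b" if "a \<in> {i \<in> I. u i \<noteq> 0}" "b \<in> {i \<in> I. u i \<noteq> 0}" for a b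
    using assms(2)[of a b] that by auto
  then show ?thesis using assms(1) by (simp add: card_le_Suc0_iff_eq)
qed

text \<open>
  With disjoint supports at most one \<open>u i\<close> and at most one \<open>v i\<close> are nonzero, so the sum on the left
  has at most two nonzero terms; this is where the factor 2 comes from.
\<close>

lemma disjoint_supp_diff_power2_le:
  fixes u v a :: "'i \<Rightarrow> real"
  assumes "finite I" "\<And>i j. i \<in> I \<Longrightarrow> j \<in> I \<Longrightarrow> i \<noteq> j \<Longrightarrow> u i * u j = 0"
    "\<And>i j. i \<in> I \<Longrightarrow> j \<in> I \<Longrightarrow> i \<noteq> j \<Longrightarrow> v i * v j = 0"
  shows "(\<Sum>i\<in>I. a i * (u i - v i))\<^sup>2 \<le> 2 * (\<Sum>i\<in>I. (a i)\<^sup>2 * (u i - v i)\<^sup>2)"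
proof -
  define J where "J = {i \<in> I. u i \<noteq> 0} \<union> {i \<in> I. v i \<noteq> 0}"
  have "card J \<le> card {i \<in> I. u i \<noteq> 0} + card {i \<in> I. v i \<noteq> 0}"
    unfolding J_def by (rule card_Un_le)
  moreover have "card {i \<in> I. u i \<noteq> 0} \<le> 1" "card {i \<in> I. v i \<noteq> 0} \<le> 1"
    by (rule disjoint_supp_card_le_1; use assms in blast)+
  ultimately have cJ: "card J \<le> 2" by linarith
  have "(\<Sum>i\<in>I. a i * (u i - v i)) = (\<Sum>i\<in>J. a i * (u i - v i))"
    by (rule sum.mono_neutral_right) (use assms(1) in \<open>auto simp: J_def\<close>)
  then have "(\<Sum>i\<in>I. a i * (u i - v i))\<^sup>2 \<le> (\<Sum>i\<in>J. (a i * (u i - v i))\<^sup>2) * card J"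
    by (simp only: sum_squared_le_sum_of_squares)
  also have "\<dots> \<le> (\<Sum>i\<in>J. (a i * (u i - v i))\<^sup>2) * 2"
    using cJ by (intro mult_left_mono sum_nonneg) auto
  also have "(\<Sum>i\<in>J. (a i * (u i - v i))\<^sup>2) \<le> (\<Sum>i\<in>I. (a i * (u i - v i))\<^sup>2)"
    by (rule sum_mono2) (use assms(1) in \<open>auto simp: J_def\<close>)
  finally show ?thesis by (simp add: power_mult_distrib)
qed

section \<open>The Laplacian and its Dirichlet form\<close>

context weighted_graph
begin

abbreviation Lap where "Lap \<equiv> laplacian E w \<mu>"
abbreviation \<Gamma> where "\<Gamma> \<equiv> Gam E w \<mu>"

definition ip :: "('v \<Rightarrow> real) \<Rightarrow> ('v \<Rightarrow> real) \<Rightarrow> real" where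
  "ip f g = (\<Sum>x\<in>UNIV. \<mu> x * (f x * g x))"

definition energy :: "('v \<Rightarrow> real) \<Rightarrow> ('v \<Rightarrow> real) \<Rightarrow> real" where
  "energy f g = (\<Sum>x\<in>UNIV. \<Sum>y\<in>UNIV. w x y * ((f x - f y) * (g x - g y))) / 2"

lemma w_eq_0: "(x, y) \<notin> E \<Longrightarrow> w x y = 0"
  using w_nonneg[of x y] w_pos_iff[of x y] by linarith

lemma sum_neighbours:
  "(\<Sum>y | (x, y) \<in> E. w x y * h y) = (\<Sum>y\<in>UNIV. w x y * h y)"
  by (rule sum.mono_neutral_left) (auto simp: w_eq_0)

lemma laplacian_eq: "Lap f x = (\<Sum>y\<in>UNIV. w x y * (f y - f x)) / \<mu> x"
  by (simp add: laplacian_def sum_neighbours)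

lemma laplacian_add: "Lap (\<lambda>y. f y + g y) x = Lap f x + Lap g x"
  by (simp add: laplacian_eq algebra_simps sum.distrib sum_subtractf add_divide_distrib diff_divide_distrib)

lemma laplacian_scale: "Lap (\<lambda>y. c * f y) x = c * Lap f x"
  by (simp add: laplacian_eq algebra_simps sum_subtractf sum_distrib_left)

lemma laplacian_const: "Lap (\<lambda>y. c) x = 0"
  by (simp add: laplacian_eq)

lemma Gam_eq:
  "\<Gamma> f g x = (\<Sum>y\<in>UNIV. w x y * ((f y - f x) * (g y - g x))) / (2 * \<mu> x)"
proof -
  define A where "A = (\<Sum>y\<in>UNIV. w x y * (f y * g y - f x * g x))"
  define B where "B = (\<Sum>y\<in>UNIV. w x y * (g y - g x))"
  define C where "C = (\<Sum>y\<in>UNIV. w x y * (f y - f x))"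
  have "(\<Sum>y\<in>UNIV. w x y * ((f y - f x) * (g y - g x))) = A - f x * B - g x * C"
    unfolding A_def B_def C_def sum_distrib_left sum_subtractf[symmetric]
    by (rule sum.cong) (auto simp: algebra_simps)
  moreover have "\<Gamma> f g x = (A / \<mu> x - f x * (B / \<mu> x) - g x * (C / \<mu> x)) / 2"
    by (simp add: Gam_def laplacian_eq A_def B_def C_def)
  ultimately show ?thesis using \<mu>_pos[of x] by (simp only:) (simp add: field_simps)
qed

lemma ip_commute: "ip f g = ip g f"
  by (simp add: ip_def mult.commute)

lemma energy_commute: "energy f g = energy g f"
  by (simp add: energy_def mult.commute)

text \<open>
  Green's formula: summation by parts on the ordered pairs of vertices.
\<close>

lemma ip_laplacian: "ip f (Lap g) = - energy f g"
proof -
  have "ip f (Lap g) = (\<Sum>x\<in>UNIV. \<Sum>y\<in>UNIV. w x y * (f x * (g y - g x)))"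
    unfolding ip_def laplacian_eq
  proof (rule sum.cong)
    fix x :: 'v
    have "\<mu> x * (f x * ((\<Sum>y\<in>UNIV. w x y * (g y - g x)) / \<mu> x))
        = f x * (\<Sum>y\<in>UNIV. w x y * (g y - g x))" using \<mu>_pos[of x] by simp
    then show "\<mu> x * (f x * ((\<Sum>y\<in>UNIV. w x y * (g y - g x)) / \<mu> x))
        = (\<Sum>y\<in>UNIV. w x y * (f x * (g y - g x)))"
      by (simp add: sum_distrib_left mult.left_commute)
  qed simp
  moreover have "\<dots> = (\<Sum>x\<in>UNIV. \<Sum>y\<in>UNIV. w x y * (f y * (g x - g y)))"
    by (subst sum.swap) (simp add: w_sym)
  moreover have "(\<Sum>x\<in>UNIV. \<Sum>y\<in>UNIV. w x y * (f x * (g y - g x)))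
      + (\<Sum>x\<in>UNIV. \<Sum>y\<in>UNIV. w x y * (f y * (g x - g y)))
    = - (\<Sum>x\<in>UNIV. \<Sum>y\<in>UNIV. w x y * ((f x - f y) * (g x - g y)))"
    unfolding sum.distrib[symmetric] sum_negf[symmetric]
    by (intro sum.cong) (auto simp: algebra_simps)
  ultimately show ?thesis by (simp add: energy_def)
qed

lemma ip_laplacian_commute: "ip (Lap f) g = ip f (Lap g)"
  by (metis energy_commute ip_commute ip_laplacian)

lemma ip_nonneg: "0 \<le> ip f f"
  unfolding ip_def by (intro sum_nonneg mult_nonneg_nonneg zero_le_square less_imp_le[OF \<mu>_pos])

lemma ip_pos:
  assumes "f x \<noteq> 0"
  shows "0 < ip f f"
proof -
  have "0 < \<mu> x * (f x * f x)" using assms \<mu>_pos[of x]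
    by (metis mult_pos_pos not_square_less_zero linorder_neqE_linordered_idom mult_neg_neg)
  also have "\<dots> \<le> ip f f" unfolding ip_def
    by (rule member_le_sum) (auto simp: \<mu>_pos less_imp_le)
  finally show ?thesis .
qed

lemma energy_nonneg: "0 \<le> energy f f"
  unfolding energy_def
  by (intro divide_nonneg_nonneg sum_nonneg mult_nonneg_nonneg[OF w_nonneg] zero_le_square) simp

lemma degree_le_D_non: "(\<Sum>y\<in>UNIV. w x y) \<le> D_non E w \<mu> * \<mu> x"
proof -
  have "(\<Sum>y | (x, y) \<in> E. w x y) / \<mu> x \<le> D_non E w \<mu>"
    unfolding D_non_def by (rule Max_ge) auto
  moreover have "(\<Sum>y | (x, y) \<in> E. w x y) = (\<Sum>y\<in>UNIV. w x y)"
    using sum_neighbours[of x "\<lambda>_. 1"] by simp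
  ultimately show ?thesis using \<mu>_pos[of x] by (simp add: field_simps)
qed

text \<open>
  Without the second assumption an isolated vertex would make one of the inner maxima a maximum over
  the empty set.
\<close>

lemma D_nor_bound:
  assumes "(x, y) \<in> E" and ne: "\<And>x. \<exists>y. (x, y) \<in> E"
  shows "\<mu> x \<le> D_nor E w \<mu> * w x y"
proof -
  have "\<mu> x / w x y \<le> (MAX y\<in>{y. (x, y) \<in> E}. \<mu> x / w x y)"
    by (rule Max_ge) (use assms in auto)
  also have "\<dots> \<le> D_nor E w \<mu>"
    unfolding D_nor_def by (rule Max_ge) auto
  finally show ?thesis using w_pos_iff[of x y] assms(1) by (simp add: field_simps)
qed

lemma exists_leaving_edge:
  assumes "S \<noteq> {}" "S \<noteq> UNIV"
  obtains x y where "x \<in> S" "y \<notin> S" "(x, y) \<in> E"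
proof -
  obtain a b where ab: "a \<in> S" "b \<notin> S" using assms by blast
  show ?thesis
  proof (rule ccontr)
    assume "\<not> ?thesis"
    then have closed: "\<And>x y. x \<in> S \<Longrightarrow> (x, y) \<in> E \<Longrightarrow> y \<in> S" using that by blast
    have "(a, b) \<in> E\<^sup>*" by (rule connected)
    then have "b \<in> S" by (induction rule: rtrancl_induct) (use ab closed in auto)
    then show False using ab by simp
  qed
qed

lemma exists_neighbour:
  assumes "2 \<le> CARD('v)"
  shows "\<exists>y. (x, y) \<in> E"
proof -
  have "{x} \<noteq> UNIV"
  proof
    assume "{x} = UNIV"
    then have "card {x} = CARD('v)" by simp
    then show False using assms by simp
  qed
  then show ?thesis using exists_leaving_edge[of "{x}"] by blast
qed

lemma boundary_weight_eq_energy: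
  "boundary_weight E w S = energy (\<lambda>x. of_bool (x \<in> S)) (\<lambda>x. of_bool (x \<in> S))"
proof -
  have b: "boundary_weight E w S = (\<Sum>x\<in>UNIV. \<Sum>y\<in>UNIV. w x y * of_bool (x \<in> S \<and> y \<notin> S))"
  proof -
    have "boundary_weight E w S = (\<Sum>(x, y) | (x, y) \<in> E \<and> x \<in> S \<and> y \<notin> S. w x y * of_bool (x \<in> S \<and> y \<notin> S))"
      unfolding boundary_weight_def by (rule sum.cong) auto
    also have "\<dots> = (\<Sum>(x, y)\<in>UNIV \<times> UNIV. w x y * of_bool (x \<in> S \<and> y \<notin> S))"
      by (rule sum.mono_neutral_left) (use w_eq_0 in fastforce)+
    also have "\<dots> = (\<Sum>x\<in>UNIV. \<Sum>y\<in>UNIV. w x y * of_bool (x \<in> S \<and> y \<notin> S))"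
      by (rule sum.cartesian_product[symmetric])
    finally show ?thesis .
  qed
  also have "\<dots> = (\<Sum>x\<in>UNIV. \<Sum>y\<in>UNIV. w x y * of_bool (y \<in> S \<and> x \<notin> S))"
    by (subst sum.swap) (simp add: w_sym)
  finally have "2 * boundary_weight E w S = (\<Sum>x\<in>UNIV. \<Sum>y\<in>UNIV. w x y * of_bool (x \<in> S \<and> y \<notin> S))
    + (\<Sum>x\<in>UNIV. \<Sum>y\<in>UNIV. w x y * of_bool (y \<in> S \<and> x \<notin> S))" using b by simp
  also have "\<dots> = (\<Sum>x\<in>UNIV. \<Sum>y\<in>UNIV. w x y
      * ((of_bool (x \<in> S) - of_bool (y \<in> S)) * (of_bool (x \<in> S) - of_bool (y \<in> S))))"
    unfolding sum.distrib[symmetric] by (intro sum.cong) auto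
  also have "\<dots> = 2 * energy (\<lambda>x. of_bool (x \<in> S)) (\<lambda>x. of_bool (x \<in> S))"
    by (simp add: energy_def)
  finally show ?thesis by simp
qed

lemma boundary_weight_Compl: "boundary_weight E w (- S) = boundary_weight E w S"
proof -
  have *: "(of_bool (x \<notin> S) - of_bool (y \<notin> S)) = - (of_bool (x \<in> S) - of_bool (y \<in> S) :: real)" for x y
    by auto
  show ?thesis unfolding boundary_weight_eq_energy energy_def Compl_iff * by (simp only: minus_mult_minus)
qed

lemma boundary_weight_pos:
  assumes "S \<noteq> {}" "S \<noteq> UNIV"
  shows "0 < boundary_weight E w S"
proof -
  obtain x y where xy: "x \<in> S" "y \<notin> S" "(x, y) \<in> E" by (rule exists_leaving_edge[OF assms])
  show ?thesis unfolding boundary_weight_def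
    by (rule sum_pos2[of _ "(x, y)"]) (use xy w_pos_iff w_nonneg in auto)
qed

lemma energy_pos:
  assumes "f a \<noteq> f b"
  shows "0 < energy f f"
proof -
  have "{z. f z = f a} \<noteq> {}" "b \<notin> {z. f z = f a}" using assms by auto
  then have "{z. f z = f a} \<noteq> {}" "{z. f z = f a} \<noteq> UNIV" by auto
  then obtain x y where "x \<in> {z. f z = f a}" "y \<notin> {z. f z = f a}" and "(x, y) \<in> E"
    by (rule exists_leaving_edge)
  then have xy: "f x = f a" "f y \<noteq> f a" "(x, y) \<in> E" by auto
  have nonneg: "0 \<le> w u v * ((f u - f v) * (f u - f v))" for u v
    using w_nonneg[of u v] by simp
  have "0 < w x y * ((f x - f y) * (f x - f y))"
  proof (rule mult_pos_pos)
    have "0 < (f x - f y)\<^sup>2" using xy by simp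
    then show "0 < (f x - f y) * (f x - f y)" by (simp add: power2_eq_square)
  qed (use xy w_pos_iff in auto)
  then have "0 < (\<Sum>v\<in>UNIV. w x v * ((f x - f v) * (f x - f v)))"
    by (rule sum_pos2[rotated 2]) (auto intro: nonneg)
  then have "0 < (\<Sum>u\<in>UNIV. \<Sum>v\<in>UNIV. w u v * ((f u - f v) * (f u - f v)))"
    by (rule sum_pos2[rotated 2]) (auto intro!: sum_nonneg nonneg)
  then show ?thesis by (simp add: energy_def)
qed

end

section \<open>The spectrum of the Laplacian\<close>

context weighted_graph
begin

text \<open>
  The Laplacian is self-adjoint for the inner product \<open>ip\<close> weighted by \<open>\<mu>\<close>. Conjugating \<open>- \<Delta>\<close> by
  multiplication with \<open>sqrt \<mu>\<close> makes it self-adjoint for the standard inner product on vectors.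
\<close>

definition sym_lap :: "real ^ 'v \<Rightarrow> real ^ 'v" where
  "sym_lap g = (\<chi> x. - (sqrt (\<mu> x) * Lap (\<lambda>y. g $ y / sqrt (\<mu> y)) x))"

lemma sqrt_\<mu>_pos: "0 < sqrt (\<mu> x)"
  by (simp add: \<mu>_pos)

lemma linear_sym_lap: "linear sym_lap"
proof (rule linearI)
  fix g h :: "real ^ 'v" and c :: real
  show "sym_lap (g + h) = sym_lap g + sym_lap h"
    using laplacian_add[of "\<lambda>y. g $ y / sqrt (\<mu> y)" "\<lambda>y. h $ y / sqrt (\<mu> y)"]
    by (simp add: sym_lap_def vec_eq_iff add_divide_distrib algebra_simps)
  show "sym_lap (c *\<^sub>R g) = c *\<^sub>R sym_lap g"
    using laplacian_scale[of c "\<lambda>y. g $ y / sqrt (\<mu> y)"]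
    by (simp add: sym_lap_def vec_eq_iff algebra_simps)
qed

lemma inner_sym_lap:
  "sym_lap g \<bullet> h = energy (\<lambda>y. g $ y / sqrt (\<mu> y)) (\<lambda>y. h $ y / sqrt (\<mu> y))"
proof -
  have "sym_lap g \<bullet> h = - ip (\<lambda>y. h $ y / sqrt (\<mu> y)) (Lap (\<lambda>y. g $ y / sqrt (\<mu> y)))"
    unfolding ip_def inner_vec_def sym_lap_def sum_negf[symmetric]
  proof (rule sum.cong)
    fix x :: 'v
    have "\<mu> x = sqrt (\<mu> x) * sqrt (\<mu> x)" using \<mu>_pos[of x] by simp
    then show "(\<chi> x. - (sqrt (\<mu> x) * Lap (\<lambda>y. g $ y / sqrt (\<mu> y)) x)) $ x \<bullet> h $ x =
         - (\<mu> x * (h $ x / sqrt (\<mu> x) * Lap (\<lambda>y. g $ y / sqrt (\<mu> y)) x))"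
      using sqrt_\<mu>_pos[of x] by (simp add: field_simps)
  qed simp
  then show ?thesis by (simp add: ip_laplacian energy_commute)
qed

lemma sym_lap_selfadjoint: "sym_lap g \<bullet> h = g \<bullet> sym_lap h"
  by (metis energy_commute inner_commute inner_sym_lap)

lemma inner_eq_ip: "g \<bullet> h = ip (\<lambda>y. g $ y / sqrt (\<mu> y)) (\<lambda>y. h $ y / sqrt (\<mu> y))"
  unfolding ip_def inner_vec_def
proof (rule sum.cong)
  fix x :: 'v
  have "\<mu> x = sqrt (\<mu> x) * sqrt (\<mu> x)" using \<mu>_pos[of x] by simp
  then show "g $ x \<bullet> h $ x = \<mu> x * (g $ x / sqrt (\<mu> x) * (h $ x / sqrt (\<mu> x)))"
    using sqrt_\<mu>_pos[of x] by (simp add: field_simps)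
qed simp

definition scale_vec :: "real ^ 'v \<Rightarrow> real ^ 'v" where
  "scale_vec f = (\<chi> x. sqrt (\<mu> x) * f $ x)"

lemma scale_vec_div: "scale_vec f $ y / sqrt (\<mu> y) = f $ y"
  using sqrt_\<mu>_pos[of y] by (simp add: scale_vec_def)

lemma linear_scale_vec: "linear scale_vec"
  by (rule linearI) (auto simp: scale_vec_def vec_eq_iff algebra_simps)

lemma inj_scale_vec: "inj scale_vec"
  by (rule injI) (metis scale_vec_div vec_eq_iff)

lemma surj_scale_vec: "surj scale_vec"
  using inj_scale_vec linear_scale_vec linear_injective_imp_surjective by blast

lemma dim_scale_vec: "dim (scale_vec ` S) = dim S"
  by (rule dim_image_eq) (auto simp: linear_scale_vec intro: inj_on_subset[OF inj_scale_vec])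

lemma sym_lap_scale_vec:
  "sym_lap (scale_vec f) = l *\<^sub>R scale_vec f \<longleftrightarrow> f \<in> eigenspace E w \<mu> l"
proof -
  have "- (sqrt (\<mu> x) * Lap (($) f) x) = l * (sqrt (\<mu> x) * f $ x)
      \<longleftrightarrow> Lap (($) f) x + l * f $ x = 0" for x
  proof -
    have "- (sqrt (\<mu> x) * Lap (($) f) x) - l * (sqrt (\<mu> x) * f $ x)
        = - sqrt (\<mu> x) * (Lap (($) f) x + l * f $ x)" by (simp add: algebra_simps)
    then show ?thesis using sqrt_\<mu>_pos[of x]
      by (metis diff_eq_diff_eq diff_self mult_eq_0_iff neg_equal_0_iff_equal order_less_irrefl)
  qed
  then show ?thesis
    by (simp add: sym_lap_def scale_vec_div vec_eq_iff eigenspace_def) (simp add: scale_vec_def)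
qed

lemma eigenspace_image: "{g. sym_lap g = l *\<^sub>R g} = scale_vec ` eigenspace E w \<mu> l"
  using surj_scale_vec sym_lap_scale_vec by (force simp: surj_def image_iff)

lemma vec_nth_vec_lambda: "($) (vec_lambda f) = f"
  by (rule ext) simp

lemma laplacian_eigenvalue_iff:
  "laplacian_eigenvalue E w \<mu> l \<longleftrightarrow> (\<exists>g. g \<noteq> 0 \<and> sym_lap g = l *\<^sub>R g)"
proof
  assume "laplacian_eigenvalue E w \<mu> l"
  then obtain f where f: "f \<noteq> (\<lambda>_. 0)" "\<And>x. Lap f x + l * f x = 0"
    by (auto simp: laplacian_eigenvalue_def)
  have "vec_lambda f \<in> eigenspace E w \<mu> l" using f by (simp add: eigenspace_def vec_nth_vec_lambda)
  moreover have "scale_vec (vec_lambda f) \<noteq> 0"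
  proof
    assume "scale_vec (vec_lambda f) = 0"
    then have "vec_lambda f = 0"
      by (metis inj_scale_vec injD linear_0 linear_scale_vec)
    then show False using f(1) by (auto simp: vec_eq_iff)
  qed
  ultimately show "\<exists>g. g \<noteq> 0 \<and> sym_lap g = l *\<^sub>R g"
    using sym_lap_scale_vec by blast
next
  assume "\<exists>g. g \<noteq> 0 \<and> sym_lap g = l *\<^sub>R g"
  then obtain f where f: "f \<in> eigenspace E w \<mu> l" "scale_vec f \<noteq> 0"
    using surj_scale_vec sym_lap_scale_vec by (metis surjD)
  then have "f \<noteq> 0" using linear_0 linear_scale_vec by blast
  then have "($) f \<noteq> (\<lambda>_. 0)" by (metis vec_eq_iff zero_index)
  then show "laplacian_eigenvalue E w \<mu> l"
    using f unfolding laplacian_eigenvalue_def eigenspace_def by blast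
qed

text \<open>
  Besides bounding \<open>\<lambda>\<^sub>k\<close>, the eigenvalue count shows that the list of eigenvalues has at least
  \<open>k\<close> entries, so that the list access defining \<open>lambda\<close> is within bounds.
\<close>

lemma lambda_le:
  assumes W: "subspace W" and k: "1 \<le> k" "k \<le> dim W"
    and bd: "\<And>f. f \<in> W \<Longrightarrow> energy (($) f) (($) f) \<le> R * ip (($) f) (($) f)"
  shows "lambda E w \<mu> k \<le> R"
proof -
  have fin: "finite {l. laplacian_eigenvalue E w \<mu> l}"
    unfolding laplacian_eigenvalue_iff
    by (rule selfadjoint_finite_eigenvalues[OF sym_lap_selfadjoint])
  have "dim W = dim (scale_vec ` W)" by (simp add: dim_scale_vec)
  also have "\<dots> \<le> (\<Sum>l | l \<le> R \<and> (\<exists>v. v \<noteq> 0 \<and> sym_lap v = l *\<^sub>R v). dim {v. sym_lap v = l *\<^sub>R v})"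
  proof (rule minmax_eigenvalue_count[OF linear_sym_lap sym_lap_selfadjoint])
    show "subspace (scale_vec ` W)"
      by (rule linear_subspace_image[OF linear_scale_vec W])
    show "sym_lap x \<bullet> x \<le> R * (x \<bullet> x)" if x: "x \<in> scale_vec ` W" for x
    proof -
      obtain f where "x = scale_vec f" "f \<in> W" using x by blast
      then show ?thesis using bd
        by (simp only: inner_sym_lap inner_eq_ip[of "scale_vec f" "scale_vec f"] scale_vec_div)
    qed
  qed
  also have "\<dots> = (\<Sum>l | laplacian_eigenvalue E w \<mu> l \<and> l \<le> R. dim (eigenspace E w \<mu> l))"
    by (intro sum.cong) (auto simp: eigenspace_image dim_scale_vec laplacian_eigenvalue_iff)
  also have "\<dots> = size (filter_mset (\<lambda>l. l \<le> R) (spectrum_mset E w \<mu>))"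
    unfolding spectrum_mset_def using size_filter_sum_replicate_mset[OF fin] by simp
  finally show ?thesis unfolding lambda_def
    using k by (intro nth_sorted_list_of_multiset_le) auto
qed

text \<open>
  The gap is the minimum of the Rayleigh quotient on the orthogonal complement of the constants. It is
  positive because on a connected graph only constants have zero energy.
\<close>

lemma spectral_gap:
  assumes "2 \<le> CARD('v)"
  obtains l f where "0 < l" "f \<noteq> (\<lambda>_. 0)" "ip (\<lambda>_. 1) f = 0" "\<And>x. Lap f x = - l * f x"
    "\<And>g. ip (\<lambda>_. 1) g = 0 \<Longrightarrow> l * ip g g \<le> energy g g"
proof -
  define o1 :: "real ^ 'v" where "o1 = scale_vec (\<chi> x. 1)"
  define V where "V = {g. o1 \<bullet> g = 0}"
  have sV: "subspace V" by (auto simp: V_def subspace_def inner_simps)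
  have To: "sym_lap o1 = 0"
    using laplacian_const[of 1] by (simp add: sym_lap_def o1_def scale_vec_div vec_eq_iff)
  have inv: "sym_lap g \<in> V" for g
    by (simp add: V_def sym_lap_selfadjoint[symmetric] To)
  have "dim V = DIM(real ^ 'v) - 1"
  proof -
    have "o1 \<noteq> 0"
      using sqrt_\<mu>_pos by (auto simp: o1_def scale_vec_def vec_eq_iff less_imp_neq[THEN not_sym])
    then show ?thesis unfolding V_def by (rule dim_hyperplane)
  qed
  then have "dim V \<noteq> 0" using assms by simp
  then have "\<exists>x\<in>V. x \<noteq> 0" by (auto simp: dim_eq_0)
  then obtain c v where v: "v \<in> V" "v \<noteq> 0" "sym_lap v = c *\<^sub>R v"
    and lower: "\<And>x. x \<in> V \<Longrightarrow> c * (x \<bullet> x) \<le> sym_lap x \<bullet> x"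
    using rayleigh_minimizer[OF linear_sym_lap sym_lap_selfadjoint sV inv] by metis
  obtain f where f: "v = scale_vec f" using surj_scale_vec by (metis surjD)
  have V_iff: "scale_vec g \<in> V \<longleftrightarrow> ip (\<lambda>_. 1) (($) g) = 0" for g
    by (simp add: V_def inner_eq_ip o1_def scale_vec_div)
  have nz: "($) f \<noteq> (\<lambda>_. 0)"
  proof
    assume "($) f = (\<lambda>_. 0)"
    then have "f = 0" by (simp add: vec_eq_iff)
    then show False using v f linear_0 linear_scale_vec by blast
  qed
  have mean: "ip (\<lambda>_. 1) (($) f) = 0" using v f V_iff by simp
  have "f \<in> eigenspace E w \<mu> c" using v f sym_lap_scale_vec by simp
  then have eig: "Lap (($) f) x = - c * f $ x" for x
    by (simp add: eigenspace_def eq_neg_iff_add_eq_0)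
  obtain a where a: "f $ a \<noteq> 0" using nz by auto
  have "\<exists>b. f $ b \<noteq> f $ a"
  proof (rule ccontr)
    assume "\<not> ?thesis"
    then have "f $ b = f $ a" for b by blast
    then have "ip (\<lambda>_. 1) (($) f) = f $ a * (\<Sum>x\<in>UNIV. \<mu> x)"
      unfolding ip_def sum_distrib_left by (intro sum.cong) simp_all
    moreover have "0 < (\<Sum>x\<in>UNIV. \<mu> x)" by (intro sum_pos) (auto simp: \<mu>_pos)
    ultimately show False using mean a by simp
  qed
  then have "0 < energy (($) f) (($) f)" by (metis energy_pos)
  moreover have "energy (($) f) (($) f) = c * ip (($) f) (($) f)"
  proof -
    have "ip (($) f) (Lap (($) f)) = - c * ip (($) f) (($) f)"
      by (simp add: ip_def eig sum_distrib_left sum_negf mult_ac)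
    then show ?thesis by (simp add: ip_laplacian)
  qed
  ultimately have "0 < c"
    using ip_nonneg[of "($) f"] by (simp add: zero_less_mult_iff)
  show ?thesis
  proof (rule that[OF \<open>0 < c\<close> nz mean eig])
    fix g :: "'v \<Rightarrow> real"
    assume "ip (\<lambda>_. 1) g = 0"
    then have "scale_vec (vec_lambda g) \<in> V" by (simp add: V_iff vec_nth_vec_lambda)
    from lower[OF this] show "c * ip g g \<le> energy g g"
      by (simp add: inner_sym_lap inner_eq_ip[of "scale_vec h" "scale_vec h" for h] scale_vec_div vec_nth_vec_lambda)
  qed
qed

end

section \<open>The Cheeger constants\<close>

context weighted_graph
begin

definition cheeger_values :: "nat \<Rightarrow> real set" where
  "cheeger_values k = {(MAX i\<in>{1..k}. expansion E w \<mu> (S i)) | S :: nat \<Rightarrow> 'v set.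
            (\<forall>i\<in>{1..k}. S i \<noteq> {}) \<and> disjoint_family_on S {1..k}}"

lemma finite_cheeger_values:
  assumes "1 \<le> k"
  shows "finite (cheeger_values k)"
proof (rule finite_subset)
  show "cheeger_values k \<subseteq> range (expansion E w \<mu>)"
  proof
    fix v assume "v \<in> cheeger_values k"
    then obtain S :: "nat \<Rightarrow> 'v set" where v: "v = (MAX i\<in>{1..k}. expansion E w \<mu> (S i))"
      by (auto simp: cheeger_values_def)
    have "v \<in> (\<lambda>i. expansion E w \<mu> (S i)) ` {1..k}"
      unfolding v by (rule Max_in) (use assms in auto)
    then show "v \<in> range (expansion E w \<mu>)" by auto
  qed
qed simp

lemma cheeger_le:
  fixes S :: "nat \<Rightarrow> 'v set"
  assumes "1 \<le> k" "\<And>i. i \<in> {1..k} \<Longrightarrow> S i \<noteq> {}" "disjoint_family_on S {1..k}"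
  shows "cheeger E w \<mu> k \<le> (MAX i\<in>{1..k}. expansion E w \<mu> (S i))"
  unfolding cheeger_def cheeger_values_def[symmetric]
proof (rule Min_le[OF finite_cheeger_values[OF assms(1)]])
  show "(MAX i\<in>{1..k}. expansion E w \<mu> (S i)) \<in> cheeger_values k"
    unfolding cheeger_values_def mem_Collect_eq using assms(2,3) by (intro exI[of _ S]) auto
qed

lemma cheeger_attained:
  assumes "1 \<le> k" "k \<le> CARD('v)"
  obtains S :: "nat \<Rightarrow> 'v set" where "\<forall>i\<in>{1..k}. S i \<noteq> {}" "disjoint_family_on S {1..k}"
    "cheeger E w \<mu> k = (MAX i\<in>{1..k}. expansion E w \<mu> (S i))"
proof -
  have "\<exists>g :: nat \<Rightarrow> 'v. inj_on g {1..k} \<and> g ` {1..k} \<subseteq> UNIV"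
    unfolding inj_on_iff_card_le[OF finite_atLeastAtMost finite] using assms by simp
  then obtain g :: "nat \<Rightarrow> 'v" where g: "inj_on g {1..k}" by blast
  have "disjoint_family_on (\<lambda>i. {g i}) {1..k}"
    by (auto simp: disjoint_family_on_def dest: inj_onD[OF g])
  then have "(MAX i\<in>{1..k}. expansion E w \<mu> {g i}) \<in> cheeger_values k"
    unfolding cheeger_values_def mem_Collect_eq by (intro exI[of _ "\<lambda>i. {g i}"]) auto
  then have "Min (cheeger_values k) \<in> cheeger_values k"
    using Min_in[OF finite_cheeger_values[OF assms(1)]] by blast
  then have "cheeger E w \<mu> k \<in> cheeger_values k"
    by (simp add: cheeger_def cheeger_values_def)
  then obtain S :: "nat \<Rightarrow> 'v set" where
    "cheeger E w \<mu> k = (MAX i\<in>{1..k}. expansion E w \<mu> (S i))"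
    and "\<forall>i\<in>{1..k}. S i \<noteq> {}" and "disjoint_family_on S {1..k}"
    unfolding cheeger_values_def mem_Collect_eq by (elim exE conjE)
  then show ?thesis by (intro that[of S]) auto
qed

lemma cheeger_2_le_cheeger:
  assumes "2 \<le> k" "k \<le> CARD('v)"
  shows "cheeger E w \<mu> 2 \<le> cheeger E w \<mu> k"
proof -
  have k1: "1 \<le> k" using assms by simp
  obtain S :: "nat \<Rightarrow> 'v set" where S: "\<forall>i\<in>{1..k}. S i \<noteq> {}" "disjoint_family_on S {1..k}"
    "cheeger E w \<mu> k = (MAX i\<in>{1..k}. expansion E w \<mu> (S i))"
    by (rule cheeger_attained[OF k1 assms(2)])
  have sub: "{1..2} \<subseteq> {1..k}" using assms by auto
  have "cheeger E w \<mu> 2 \<le> (MAX i\<in>{1..2}. expansion E w \<mu> (S i))"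
    by (rule cheeger_le) (use S sub disjoint_family_on_mono[OF sub S(2)] in auto)
  also have "\<dots> \<le> (MAX i\<in>{1..k}. expansion E w \<mu> (S i))"
    by (rule Max_mono) (use sub in auto)
  finally show ?thesis using S(3) by simp
qed

lemma measure_pos:
  assumes "S \<noteq> {}"
  shows "0 < sum \<mu> S"
  using assms by (intro sum_pos) (auto simp: \<mu>_pos)

text \<open>
  Take the pair \<open>S\<close>, \<open>- S\<close>: both sets have the same boundary, so the smaller one has the larger
  expansion.
\<close>

lemma cheeger_2_le:
  assumes S: "S \<noteq> {}" and half: "sum \<mu> S \<le> sum \<mu> (- S)"
  shows "cheeger E w \<mu> 2 * sum \<mu> S \<le> boundary_weight E w S"
proof -
  have ne: "- S \<noteq> {}"
    using half measure_pos[OF S] by auto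
  define T where "T i = (if i = 1 then S else - S)" for i :: nat
  have 12: "{1..2} = {1, 2::nat}" by auto
  have "cheeger E w \<mu> 2 \<le> (MAX i\<in>{1..2}. expansion E w \<mu> (T i))"
    by (rule cheeger_le) (use S ne in \<open>auto simp: T_def disjoint_family_on_def 12\<close>)
  also have "\<dots> = max (expansion E w \<mu> S) (expansion E w \<mu> (- S))"
    unfolding 12 T_def by simp
  also have "expansion E w \<mu> (- S) \<le> expansion E w \<mu> S"
  proof -
    have "0 \<le> boundary_weight E w S" by (simp add: boundary_weight_eq_energy energy_nonneg)
    then show ?thesis unfolding expansion_def boundary_weight_Compl
      using half measure_pos[OF S] measure_pos[OF ne] by (intro divide_left_mono) auto
  qed
  then have "max (expansion E w \<mu> S) (expansion E w \<mu> (- S)) = expansion E w \<mu> S" by simp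
  finally show ?thesis using measure_pos[OF S] by (simp add: expansion_def field_simps)
qed

text \<open>
  Of two disjoint sets, the one of smaller measure has at most half of the total measure.
\<close>

lemma cheeger_2_attained:
  assumes "2 \<le> CARD('v)"
  obtains S where "S \<noteq> {}" "S \<noteq> UNIV" "sum \<mu> S \<le> sum \<mu> (- S)"
    "boundary_weight E w S \<le> cheeger E w \<mu> 2 * sum \<mu> S"
proof -
  obtain T :: "nat \<Rightarrow> 'v set" where T: "\<forall>i\<in>{1..2}. T i \<noteq> {}" "disjoint_family_on T {1..2}"
    "cheeger E w \<mu> 2 = (MAX i\<in>{1..2}. expansion E w \<mu> (T i))"
    by (rule cheeger_attained[of 2]) (use assms in auto)
  have ne: "T 1 \<noteq> {}" "T 2 \<noteq> {}" using T(1) by auto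
  have disj: "T 1 \<inter> T 2 = {}" using T(2) by (auto simp: disjoint_family_on_def)
  have le: "expansion E w \<mu> (T i) \<le> cheeger E w \<mu> 2" if "i \<in> {1..2}" for i
    unfolding T(3) by (rule Max_ge) (use that in auto)
  have "\<exists>i\<in>{1,2::nat}. sum \<mu> (T i) \<le> sum \<mu> (- T i)"
  proof (cases "sum \<mu> (T 1) \<le> sum \<mu> (T 2)")
    case True
    have "sum \<mu> (T 2) \<le> sum \<mu> (- T 1)"
      by (rule sum_mono2) (use disj \<mu>_pos less_imp_le in auto)
    then show ?thesis using True by auto
  next
    case False
    have "sum \<mu> (T 1) \<le> sum \<mu> (- T 2)"
      by (rule sum_mono2) (use disj \<mu>_pos less_imp_le in auto)
    then show ?thesis using False by auto
  qed
  then obtain i where i: "i \<in> {1,2}" "sum \<mu> (T i) \<le> sum \<mu> (- T i)" by blast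
  show ?thesis
  proof (rule that[of "T i"])
    show "T i \<noteq> {}" "sum \<mu> (T i) \<le> sum \<mu> (- T i)" using ne i by auto
    then show "T i \<noteq> UNIV" using measure_pos[of "T i"] by auto
    show "boundary_weight E w (T i) \<le> cheeger E w \<mu> 2 * sum \<mu> (T i)"
    proof -
      have "0 < sum \<mu> (T i)" by (rule measure_pos) fact
      moreover have "expansion E w \<mu> (T i) \<le> cheeger E w \<mu> 2" by (rule le) (use i in auto)
      ultimately show ?thesis by (simp add: expansion_def pos_divide_le_eq)
    qed
  qed
qed

lemma cheeger_2_pos:
  assumes "2 \<le> CARD('v)"
  shows "0 < cheeger E w \<mu> 2"
proof -
  obtain S where S: "S \<noteq> {}" "S \<noteq> UNIV" "boundary_weight E w S \<le> cheeger E w \<mu> 2 * sum \<mu> S"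
    by (rule cheeger_2_attained[OF assms])
  have "0 < cheeger E w \<mu> 2 * sum \<mu> S" using boundary_weight_pos[OF S(1,2)] S(3) by linarith
  then show ?thesis using measure_pos[OF S(1)] by (simp add: zero_less_mult_iff)
qed

end

section \<open>The coarea inequality and eigenvalue bounds from test functions\<close>

context weighted_graph
begin

text \<open>
  A discrete substitute for integrating over the level sets of \<open>h\<close>: subtracting from \<open>h\<close> its least
  positive value \<open>m\<close> on its support \<open>S\<close> lowers the left side by \<open>\<phi> * m * \<mu>(S)\<close> and the right side
  by \<open>m\<close> times the boundary weight of \<open>S\<close>, and shrinks the support.
\<close>

lemma coarea:
  fixes h :: "'v \<Rightarrow> real"
  assumes "\<And>x. 0 \<le> h x"
    and "\<And>S. S \<noteq> {} \<Longrightarrow> S \<subseteq> {x. h x \<noteq> 0} \<Longrightarrow> \<phi> * sum \<mu> S \<le> boundary_weight E w S"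
  shows "\<phi> * (\<Sum>x\<in>UNIV. \<mu> x * h x) \<le> (\<Sum>x\<in>UNIV. \<Sum>y\<in>UNIV. w x y * \<bar>h x - h y\<bar>) / 2"
  using assms
proof (induction "card {x. h x \<noteq> 0}" arbitrary: h rule: less_induct)
  case less
  define S where "S = {x. h x \<noteq> 0}"
  show ?case
  proof (cases "S = {}")
    case True
    then have "h x = 0" for x by (auto simp: S_def)
    then show ?thesis by simp
  next
    case False
    define m where "m = Min (h ` S)"
    define h' where "h' x = h x - m * of_bool (x \<in> S)" for x
    have m_le: "m \<le> h x" if "x \<in> S" for x unfolding m_def by (rule Min_le) (use that in auto)
    have "m \<in> h ` S" unfolding m_def by (rule Min_in) (use False in auto)
    then obtain z where z: "z \<in> S" "h z = m" by auto
    have m0: "0 < m" using z less.prems(1)[of z] by (auto simp: S_def)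
    have h'0: "0 \<le> h' x" for x using m_le[of x] less.prems(1)[of x] by (auto simp: h'_def)
    have sub: "{x. h' x \<noteq> 0} \<subset> S"
    proof
      show "{x. h' x \<noteq> 0} \<subseteq> S" by (auto simp: h'_def S_def)
      have "h' z = 0" using z by (simp add: h'_def)
      then show "{x. h' x \<noteq> 0} \<noteq> S" using z by auto
    qed
    have "\<phi> * (\<Sum>x\<in>UNIV. \<mu> x * h' x) \<le> (\<Sum>x\<in>UNIV. \<Sum>y\<in>UNIV. w x y * \<bar>h' x - h' y\<bar>) / 2"
    proof (rule less.hyps)
      show "card {x. h' x \<noteq> 0} < card {x. h x \<noteq> 0}"
        using sub by (intro psubset_card_mono) (auto simp: S_def)
      show "\<phi> * sum \<mu> T \<le> boundary_weight E w T" if "T \<noteq> {}" "T \<subseteq> {x. h' x \<noteq> 0}" for T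
        by (rule less.prems(2)) (use that sub S_def in auto)
    qed (rule h'0)
    moreover have "m * (\<phi> * sum \<mu> S) \<le> m * boundary_weight E w S"
      using less.prems(2)[OF False] m0 by (intro mult_left_mono) (auto simp: S_def)
    moreover have "(\<Sum>x\<in>UNIV. \<mu> x * h x) = (\<Sum>x\<in>UNIV. \<mu> x * h' x) + m * sum \<mu> S"
    proof -
      have "sum \<mu> S = (\<Sum>x\<in>UNIV. \<mu> x * of_bool (x \<in> S))" by simp
      then show ?thesis
        by (simp only: sum_distrib_left sum.distrib[symmetric] h'_def) (simp add: algebra_simps)
    qed
    moreover have "(\<Sum>x\<in>UNIV. \<Sum>y\<in>UNIV. w x y * \<bar>h x - h y\<bar>) / 2
      = (\<Sum>x\<in>UNIV. \<Sum>y\<in>UNIV. w x y * \<bar>h' x - h' y\<bar>) / 2 + m * boundary_weight E w S"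
    proof -
      have pt: "\<bar>h x - h y\<bar> = \<bar>h' x - h' y\<bar>
        + m * ((of_bool (x \<in> S) - of_bool (y \<in> S)) * (of_bool (x \<in> S) - of_bool (y \<in> S)))" for x y
        using m_le[of x] m_le[of y] m0 by (auto simp: h'_def S_def)
      show ?thesis unfolding boundary_weight_eq_energy energy_def pt
        by (simp only: distrib_left sum.distrib add_divide_distrib)
          (simp add: sum_distrib_left mult.left_commute)
    qed
    ultimately show ?thesis by (simp add: algebra_simps)
  qed
qed

lemma sum_degree_le:
  assumes "\<And>x. 0 \<le> g x"
  shows "(\<Sum>x\<in>UNIV. \<Sum>y\<in>UNIV. w x y * (g x + g y)) / 2 \<le> D_non E w \<mu> * (\<Sum>x\<in>UNIV. \<mu> x * g x)"
proof -
  have "(\<Sum>x\<in>UNIV. \<Sum>y\<in>UNIV. w x y * g y) = (\<Sum>x\<in>UNIV. \<Sum>y\<in>UNIV. w x y * g x)"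
    by (subst sum.swap) (simp add: w_sym)
  then have "(\<Sum>x\<in>UNIV. \<Sum>y\<in>UNIV. w x y * (g x + g y)) / 2 = (\<Sum>x\<in>UNIV. (\<Sum>y\<in>UNIV. w x y) * g x)"
    by (simp add: distrib_left sum.distrib sum_distrib_right)
  also have "\<dots> \<le> (\<Sum>x\<in>UNIV. (D_non E w \<mu> * \<mu> x) * g x)"
    by (intro sum_mono mult_right_mono degree_le_D_non assms)
  finally show ?thesis by (simp add: sum_distrib_left mult.assoc)
qed

lemma lambda_le_2_D_non:
  assumes "1 \<le> k" "k \<le> CARD('v)"
  shows "lambda E w \<mu> k \<le> 2 * D_non E w \<mu>"
proof (rule lambda_le[of UNIV])
  show "k \<le> dim (UNIV :: (real ^ 'v) set)" using assms by simp
  fix f :: "real ^ 'v"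
  have "energy (($) f) (($) f) \<le> (\<Sum>x\<in>UNIV. \<Sum>y\<in>UNIV. w x y * (2 * (f $ x)\<^sup>2 + 2 * (f $ y)\<^sup>2)) / 2"
    unfolding energy_def
  proof (intro divide_right_mono sum_mono mult_left_mono w_nonneg)
    fix x y
    have "0 \<le> (f $ x + f $ y)\<^sup>2" by simp
    then show "(f $ x - f $ y) * (f $ x - f $ y) \<le> 2 * (f $ x)\<^sup>2 + 2 * (f $ y)\<^sup>2"
      by (simp add: power2_eq_square algebra_simps)
  qed simp
  also have "\<dots> \<le> D_non E w \<mu> * (\<Sum>x\<in>UNIV. \<mu> x * (2 * (f $ x)\<^sup>2))"
    by (rule sum_degree_le) simp
  also have "\<dots> = 2 * D_non E w \<mu> * ip (($) f) (($) f)"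
    by (simp add: ip_def power2_eq_square sum_distrib_left mult_ac)
  finally show "energy (($) f) (($) f) \<le> 2 * D_non E w \<mu> * ip (($) f) (($) f)" .
qed (use assms in auto)

text \<open>
  The \<open>F i\<close> span a space of dimension \<open>card I\<close>. Functions with disjoint supports need not have
  orthogonal gradients, which costs a factor 2 in the energy of a linear combination.
\<close>

lemma lambda_le_disjoint:
  fixes F :: "'i \<Rightarrow> 'v \<Rightarrow> real"
  assumes I: "finite I" "I \<noteq> {}"
    and disj: "\<And>i j x. i \<in> I \<Longrightarrow> j \<in> I \<Longrightarrow> i \<noteq> j \<Longrightarrow> F i x * F j x = 0"
    and pos: "\<And>i. i \<in> I \<Longrightarrow> 0 < ip (F i) (F i)"
    and bd: "\<And>i. i \<in> I \<Longrightarrow> energy (F i) (F i) \<le> R * ip (F i) (F i)"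
  shows "lambda E w \<mu> (card I) \<le> 2 * R"
proof -
  define G where "G i = (\<chi> x. F i x)" for i
  have orth: "G i \<bullet> G j = 0" if "i \<in> I" "j \<in> I" "i \<noteq> j" for i j
    unfolding G_def inner_vec_def using disj[OF that] by (intro sum.neutral) simp
  have nz: "G i \<noteq> 0" if "i \<in> I" for i
  proof
    assume "G i = 0"
    then have "F i x = 0" for x by (simp add: G_def vec_eq_iff)
    then have "ip (F i) (F i) = 0" by (simp add: ip_def)
    then show False using pos[OF that] by simp
  qed
  have inj: "inj_on G I"
    by (rule inj_onI) (metis nz orth inner_eq_zero_iff)
  have "independent (G ` I)"
  proof (rule pairwise_orthogonal_independent)
    show "pairwise orthogonal (G ` I)"
      unfolding pairwise_def orthogonal_def using orth by blast
  qed (use nz in auto)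
  then have dim: "dim (span (G ` I)) = card I"
    using inj by (simp add: dim_eq_card_independent card_image)
  show ?thesis
  proof (rule lambda_le[of "span (G ` I)"])
    show "1 \<le> card I" using I by (simp add: Suc_le_eq card_gt_0_iff)
    show "card I \<le> dim (span (G ` I))" using dim by simp
    fix f assume "f \<in> span (G ` I)"
    then obtain u where u: "f = (\<Sum>v\<in>G ` I. u v *\<^sub>R v)"
      using I(1) by (auto simp: span_finite)
    define a where "a i = u (G i)" for i
    have "f = (\<Sum>i\<in>I. a i *\<^sub>R G i)" unfolding u a_def by (simp add: sum.reindex[OF inj])
    then have f: "f $ x = (\<Sum>i\<in>I. a i * F i x)" for x by (simp add: G_def)
    have f2: "f $ x * f $ x = (\<Sum>i\<in>I. (a i)\<^sup>2 * (F i x * F i x))" for x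
    proof -
      have "f $ x * f $ x = (\<Sum>i\<in>I. \<Sum>j\<in>I. a i * F i x * (a j * F j x))"
        unfolding f by (rule sum_product)
      also have "\<dots> = (\<Sum>i\<in>I. \<Sum>j\<in>I. if j = i then (a i)\<^sup>2 * (F i x * F i x) else 0)"
        using disj by (intro sum.cong refl) (auto simp: power2_eq_square)
      finally show ?thesis using I(1) by simp
    qed
    have ipf: "ip (($) f) (($) f) = (\<Sum>i\<in>I. (a i)\<^sup>2 * ip (F i) (F i))"
      unfolding ip_def f2 sum_distrib_left by (subst sum.swap) (simp add: mult_ac)
    have "energy (($) f) (($) f)
      \<le> (\<Sum>x\<in>UNIV. \<Sum>y\<in>UNIV. w x y * (2 * (\<Sum>i\<in>I. (a i)\<^sup>2 * (F i x - F i y)\<^sup>2))) / 2"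
      unfolding energy_def
    proof (intro divide_right_mono sum_mono mult_left_mono w_nonneg)
      fix x y
      have "(f $ x - f $ y) = (\<Sum>i\<in>I. a i * (F i x - F i y))"
        by (simp add: f sum_subtractf right_diff_distrib)
      then show "(f $ x - f $ y) * (f $ x - f $ y) \<le> 2 * (\<Sum>i\<in>I. (a i)\<^sup>2 * (F i x - F i y)\<^sup>2)"
        using disjoint_supp_diff_power2_le[OF I(1), of "\<lambda>i. F i x" "\<lambda>i. F i y" a] disj
        by (simp add: power2_eq_square)
    qed simp
    also have "\<dots> = (\<Sum>i\<in>I. 2 * (a i)\<^sup>2 * energy (F i) (F i))"
    proof -
      have "(\<Sum>x\<in>UNIV. \<Sum>y\<in>UNIV. w x y * (2 * (\<Sum>i\<in>I. (a i)\<^sup>2 * (F i x - F i y)\<^sup>2)))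
        = (\<Sum>x\<in>UNIV. \<Sum>y\<in>UNIV. \<Sum>i\<in>I. 2 * (a i)\<^sup>2 * (w x y * ((F i x - F i y) * (F i x - F i y))))"
        unfolding sum_distrib_left power2_eq_square
        by (intro sum.cong refl) (simp only: mult_ac)
      also have "\<dots> = (\<Sum>x\<in>UNIV. \<Sum>i\<in>I. \<Sum>y\<in>UNIV. 2 * (a i)\<^sup>2 * (w x y * ((F i x - F i y) * (F i x - F i y))))"
        by (intro sum.cong refl sum.swap)
      also have "\<dots> = (\<Sum>i\<in>I. \<Sum>x\<in>UNIV. \<Sum>y\<in>UNIV. 2 * (a i)\<^sup>2 * (w x y * ((F i x - F i y) * (F i x - F i y))))"
        by (rule sum.swap)
      finally show ?thesis
        by (simp only: energy_def sum_divide_distrib sum_distrib_left times_divide_eq_right)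
    qed
    also have "\<dots> \<le> (\<Sum>i\<in>I. 2 * (a i)\<^sup>2 * (R * ip (F i) (F i)))"
      using bd by (intro sum_mono mult_left_mono) auto
    also have "\<dots> = 2 * R * ip (($) f) (($) f)"
      by (simp add: ipf sum_distrib_left mult_ac)
    finally show "energy (($) f) (($) f) \<le> 2 * R * ip (($) f) (($) f)" .
  qed simp
qed

end

section \<open>The Cheeger inequality with a higher eigenvalue\<close>

text \<open>
  The thresholds are chosen greedily: each interval is made as long as the budget \<open>C\<close> for its cost
  allows. By the intermediate value theorem the budget is used up exactly unless \<open>M\<close> is reached.
\<close>

lemma threshold_sequence:
  fixes c :: "real \<Rightarrow> real \<Rightarrow> real"
  assumes M: "0 \<le> M" and C: "0 \<le> C"
    and c0: "\<And>a. c a a = 0" and cont: "\<And>a. continuous_on {a..M} (c a)"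
  obtains t :: "nat \<Rightarrow> real" where "mono t" "t 0 = 0" "\<And>i. t i \<le> M"
    "\<And>i. c (t i) (t (Suc i)) \<le> C" "\<And>i. t (Suc i) < M \<Longrightarrow> c (t i) (t (Suc i)) = C"
proof -
  have "\<exists>b. a \<le> b \<and> b \<le> M \<and> c a b \<le> C \<and> (b < M \<longrightarrow> c a b = C)" if a: "a \<le> M" for a
  proof (cases "c a M \<le> C")
    case True
    then show ?thesis using a by (intro exI[of _ M]) auto
  next
    case False
    have "\<exists>b\<ge>a. b \<le> M \<and> c a b = C"
      by (rule IVT') (use False a C c0 cont in auto)
    then show ?thesis by auto
  qed
  then obtain nxt where nxt: "\<And>a. a \<le> M \<Longrightarrow> a \<le> nxt a \<and> nxt a \<le> M \<and> c a (nxt a) \<le> C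
      \<and> (nxt a < M \<longrightarrow> c a (nxt a) = C)"
    by metis
  define t where "t i = (nxt ^^ i) 0" for i
  have tM: "t i \<le> M" for i by (induction i) (use M nxt in \<open>auto simp: t_def\<close>)
  have tS: "t (Suc i) = nxt (t i)" for i by (simp add: t_def)
  show ?thesis
  proof (rule that[of t])
    show "mono t" by (rule incseq_SucI) (use nxt tM tS in auto)
    show "t 0 = 0" by (simp add: t_def)
  qed (use nxt tM tS in auto)
qed

text \<open>
  More than \<open>k\<close> of the \<open>2 * k\<close> summands exceeding \<open>A / (k + 1)\<close> would make the sum exceed \<open>A\<close>. The
  bound \<open>A / (k + 1)\<close>, rather than \<open>A / k\<close>, gives the strict inequality on which the choice of
  thresholds relies.
\<close>

lemma card_small_summands:
  fixes e :: "nat \<Rightarrow> real"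
  assumes "\<And>i. 0 \<le> e i" and sum: "(\<Sum>i<2 * k. e i) \<le> A"
  shows "k \<le> card {i. i < 2 * k \<and> e i \<le> A / (real k + 1)}"
proof (rule ccontr)
  assume neg: "\<not> ?thesis"
  let ?B = "{i. i < 2 * k \<and> \<not> e i \<le> A / (real k + 1)}"
  have "card {i. i < 2 * k \<and> e i \<le> A / (real k + 1)} + card ?B
    = card ({i. i < 2 * k \<and> e i \<le> A / (real k + 1)} \<union> ?B)"
    by (rule card_Un_disjoint[symmetric]) auto
  also have "{i. i < 2 * k \<and> e i \<le> A / (real k + 1)} \<union> ?B = {..<2 * k}" by auto
  finally have cB: "k + 1 \<le> card ?B" using neg by simp
  have A0: "0 \<le> A" using sum sum_nonneg[of "{..<2 * k}" e] assms(1) by (meson order_trans)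
  have "A \<le> (\<Sum>i\<in>?B. A / (real k + 1))"
  proof -
    have "A = (real k + 1) * (A / (real k + 1))" by simp
    also have "\<dots> \<le> card ?B * (A / (real k + 1))"
      using cB A0 by (intro mult_right_mono) auto
    finally show ?thesis by simp
  qed
  also have "\<dots> < (\<Sum>i\<in>?B. e i)"
  proof (rule sum_strict_mono)
    show "?B \<noteq> {}" using cB by (metis card.empty le_zero_eq add_is_0 one_neq_zero)
  qed auto
  also have "\<dots> \<le> (\<Sum>i<2 * k. e i)"
    by (rule sum_mono2) (use assms(1) in auto)
  finally show False using sum by simp
qed

context weighted_graph
begin

text \<open>
  The function \<open>h\<close> of the proof is \<open>f\<close> composed with the integral of the distance \<open>d\<close> to the
  thresholds. It is at least \<open>f\<^sup>2 / (8 k)\<close>, while its variation along an edge is governed by \<open>d\<close> and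
  by the square of the variation of \<open>f\<close>. The lower bound on \<open>\<lambda>\<^sub>k\<close> enters through the smallness of
  \<open>d\<close> in the weighted \<open>L\<^sup>2\<close> norm.
\<close>

lemma improved_cheeger:
  fixes f :: "'v \<Rightarrow> real"
  assumes k: "1 \<le> k" "k \<le> CARD('v)" and pos: "0 < lambda E w \<mu> k"
    and f0: "\<And>x. 0 \<le> f x" and fN: "0 < ip f f" and r: "0 < r" and fr: "energy f f \<le> r * ip f f"
    and \<phi>0: "0 \<le> \<phi>"
    and \<phi>: "\<And>S. S \<noteq> {} \<Longrightarrow> S \<subseteq> {x. f x \<noteq> 0} \<Longrightarrow> \<phi> * sum \<mu> S \<le> boundary_weight E w S"
  shows "\<phi> \<le> 5 * real k * sqrt (8 * D_non E w \<mu> / lambda E w \<mu> k) * r"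
proof -
  let ?L = "lambda E w \<mu> k" and ?D = "D_non E w \<mu>"
  define N where "N = ip f f"
  \<comment> \<open>The budget for which \<open>2 * k\<close> intervals of full cost would force \<open>\<lambda>\<^sub>k \<le> \<lambda>\<^sub>k * k / (k + 1)\<close>.\<close>
  define C where "C = 2 * r * N / (k * ?L)"
  have C0: "0 < C" using k pos r fN by (simp add: C_def N_def)
  define cost where "cost a b = (\<Sum>x\<in>UNIV. \<mu> x * (bump a b (f x))\<^sup>2)" for a b
  define M where "M = Max (range f)"
  have fM: "f x \<le> M" for x unfolding M_def by (rule Max_ge) auto
  have M0: "0 \<le> M" using f0 fM order_trans by blast
  have cost0: "cost a a = 0" for a by (simp add: cost_def bump_def)
  have cont: "continuous_on {a..M} (cost a)" for a
    unfolding cost_def bump_def by (intro continuous_intros)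
  obtain t where t: "mono t" "t 0 = 0" "\<And>i. t i \<le> M"
    "\<And>i. cost (t i) (t (Suc i)) \<le> C" "\<And>i. t (Suc i) < M \<Longrightarrow> cost (t i) (t (Suc i)) = C"
    by (rule threshold_sequence[of M C cost]) (use M0 C0 cost0 cont in auto)
  define B where "B i s = bump (t i) (t (Suc i)) s" for i s
  define m where "m = 2 * k"
  \<comment> \<open>Otherwise every interval has cost exactly \<open>C\<close>, and the bumps composed with \<open>f\<close> are test
    functions that make \<open>\<lambda>\<^sub>k\<close> too small.\<close>
  have tm: "t m = M"
  proof (rule ccontr)
    assume "t m \<noteq> M"
    then have lt: "t m < M" using t(3)[of m] by simp
    define F where "F i x = B i (f x)" for i x
    have ipF: "ip (F i) (F i) = C" if "i < m" for i
    proof -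
      have "t (Suc i) \<le> t m" using that t(1) by (simp add: mono_def)
      then have "cost (t i) (t (Suc i)) = C" using lt t(5) by simp
      then show ?thesis by (simp add: ip_def F_def B_def cost_def power2_eq_square)
    qed
    have "(\<Sum>i<2 * k. energy (F i) (F i)) \<le> r * N"
    proof -
      have "(\<Sum>i<m. energy (F i) (F i))
        = (\<Sum>i<m. \<Sum>x\<in>UNIV. \<Sum>y\<in>UNIV. w x y * (F i x - F i y)\<^sup>2) / 2"
        by (simp add: energy_def power2_eq_square sum_divide_distrib)
      also have "(\<Sum>i<m. \<Sum>x\<in>UNIV. \<Sum>y\<in>UNIV. w x y * (F i x - F i y)\<^sup>2)
        = (\<Sum>x\<in>UNIV. \<Sum>i<m. \<Sum>y\<in>UNIV. w x y * (F i x - F i y)\<^sup>2)"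
        by (rule sum.swap)
      also have "\<dots> = (\<Sum>x\<in>UNIV. \<Sum>y\<in>UNIV. \<Sum>i<m. w x y * (F i x - F i y)\<^sup>2)"
        by (intro sum.cong refl sum.swap)
      also have "\<dots> \<le> (\<Sum>x\<in>UNIV. \<Sum>y\<in>UNIV. w x y * (f x - f y)\<^sup>2)"
        unfolding sum_distrib_left[symmetric] F_def B_def
        by (intro sum_mono mult_left_mono w_nonneg sum_bump_diff_power2_le t(1))
      finally have "(\<Sum>i<m. energy (F i) (F i)) \<le> energy f f"
        by (simp add: energy_def power2_eq_square)
      then show ?thesis using fr by (simp add: N_def m_def)
    qed
    from card_small_summands[of "\<lambda>i. energy (F i) (F i)", OF energy_nonneg this]
    obtain I where I: "I \<subseteq> {i. i < 2 * k \<and> energy (F i) (F i) \<le> r * N / (real k + 1)}"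
      "card I = k" "finite I"
      by (rule obtain_subset_with_card_n)
    define R where "R = r * N / ((real k + 1) * C)"
    have "lambda E w \<mu> (card I) \<le> 2 * R"
    proof (rule lambda_le_disjoint)
      show "finite I" "I \<noteq> {}" using I k by auto
      show "F i x * F j x = 0" if "i \<noteq> j" for i j x
        unfolding F_def B_def by (rule bump_disjoint) (use t(1) that in auto)
      show "0 < ip (F i) (F i)" if "i \<in> I" for i
        using ipF[of i] I(1) that C0 by (auto simp: m_def)
      show "energy (F i) (F i) \<le> R * ip (F i) (F i)" if "i \<in> I" for i
      proof -
        have "i < m" "energy (F i) (F i) \<le> r * N / (real k + 1)" using I(1) that by (auto simp: m_def)
        then show ?thesis using C0 by (simp add: ipF R_def)
      qed
    qed
    then have "?L \<le> 2 * R" using I by simp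
    also have "2 * R = ?L * (k / (real k + 1))"
    proof -
      have cancel: "A / (K1 * (A / (K * L))) = L * (K / K1)"
        if "0 < A" "0 < K1" "0 < K" "0 < L" for A K1 K L :: real
        using that by (simp add: field_simps)
      show ?thesis
        using cancel[of "2 * r * N" "real k + 1" k ?L] k pos r fN
        by (simp only: R_def C_def times_divide_eq_right mult.assoc) (simp add: N_def)
    qed
    also have "\<dots> < ?L * 1" using pos by (intro mult_strict_left_mono) auto
    finally show False by simp
  qed
  define d where "d x = (\<Sum>i<m. B i (f x))" for x
  have d0: "0 \<le> d x" for x unfolding d_def B_def by (intro sum_nonneg bump_nonneg)
  have d2: "(\<Sum>x\<in>UNIV. \<mu> x * (d x)\<^sup>2) \<le> 4 * r * N / ?L"
  proof -
    have "(d x)\<^sup>2 = (\<Sum>i<m. (B i (f x))\<^sup>2)" for x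
    proof -
      have "(d x)\<^sup>2 = (\<Sum>i<m. \<Sum>j<m. B i (f x) * B j (f x))"
        unfolding d_def power2_eq_square by (rule sum_product)
      also have "\<dots> = (\<Sum>i<m. \<Sum>j<m. if j = i then (B i (f x))\<^sup>2 else 0)"
        using bump_disjoint[OF t(1)] by (intro sum.cong refl) (auto simp: power2_eq_square B_def)
      finally show ?thesis by simp
    qed
    then have "(\<Sum>x\<in>UNIV. \<mu> x * (d x)\<^sup>2) = (\<Sum>i<m. cost (t i) (t (Suc i)))"
      unfolding cost_def B_def by (subst sum.swap) (simp add: sum_distrib_left)
    also have "\<dots> \<le> (\<Sum>i<m. C)" by (intro sum_mono t(4))
    also have "\<dots> = 4 * r * N / ?L" using k by (simp add: C_def m_def)
    finally show ?thesis .
  qed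
  define h where "h x = (\<Sum>i<m. bump_area (t i) (t (Suc i)) (f x))" for x
  have h_lower: "(f x)\<^sup>2 \<le> 8 * k * h x" for x
  proof -
    have "(f x)\<^sup>2 \<le> 4 * real m * h x"
      using sum_bump_area_lower[OF t(1), of "f x" m] f0[of x] fM[of x] by (simp add: t(2) tm h_def)
    then show ?thesis by (simp add: m_def)
  qed
  have h_diff: "\<bar>h x - h y\<bar> \<le> \<bar>f x - f y\<bar> * (d x + d y) / 2 + (f x - f y)\<^sup>2 / 4" for x y
  proof -
    have *: "\<bar>h x - h y\<bar> \<le> \<bar>f x - f y\<bar> * (d x + d y) / 2 + (f x - f y)\<^sup>2 / 4" if "f x \<le> f y" for x y
      using sum_bump_area_increment[OF t(1) that, of m] that
      by (simp add: h_def d_def B_def power2_commute[of "f x"] add.commute)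
    show ?thesis
    proof (cases "f x \<le> f y")
      case False
      then show ?thesis using *[of y x]
        by (simp add: abs_minus_commute power2_commute[of "f x"] add.commute)
    qed (rule *)
  qed
  have h_supp: "h x = 0" if "f x = 0" for x
  proof -
    have "bump_area (t i) (t (Suc i)) 0 = 0" for i
    proof -
      have "0 \<le> t i" "t i \<le> t (Suc i)" using t(1) t(2) by (metis monoD le0, simp add: mono_def)
      then show ?thesis by (simp add: bump_area_def proj_def min_def Let_def)
    qed
    then show ?thesis using that by (simp add: h_def)
  qed
  \<comment> \<open>The weight in the arithmetic-geometric mean inequality below that balances the energy of \<open>f\<close>
    against the norm of \<open>d\<close>.\<close>
  define \<theta> where "\<theta> = sqrt (8 * ?D / ?L)"
  have \<theta>2: "2 \<le> \<theta>"
  proof -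
    have "4 \<le> 8 * ?D / ?L" using lambda_le_2_D_non[OF k] pos by (simp add: field_simps)
    then show ?thesis unfolding \<theta>_def by (intro real_le_rsqrt) simp
  qed
  have \<theta>sq: "?D / ?L = \<theta>\<^sup>2 / 8"
  proof -
    have "0 \<le> 8 * ?D / ?L" using lambda_le_2_D_non[OF k] pos by simp
    then show ?thesis by (simp add: \<theta>_def)
  qed
  have "\<phi> * (\<Sum>x\<in>UNIV. \<mu> x * h x) \<le> (\<Sum>x\<in>UNIV. \<Sum>y\<in>UNIV. w x y * \<bar>h x - h y\<bar>) / 2"
  proof (rule coarea)
    show "0 \<le> h x" for x
    proof -
      have "0 \<le> 8 * real k * h x" using h_lower[of x] zero_le_power2[of "f x"] by linarith
      then show ?thesis using k by (simp add: zero_le_mult_iff)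
    qed
    show "\<phi> * sum \<mu> S \<le> boundary_weight E w S" if "S \<noteq> {}" "S \<subseteq> {x. h x \<noteq> 0}" for S
      using \<phi>[OF that(1)] that(2) h_supp by blast
  qed
  also have "\<dots> \<le> (\<Sum>x\<in>UNIV. \<Sum>y\<in>UNIV. w x y *
      ((\<theta> + 1) / 4 * (f x - f y)\<^sup>2 + ((d x)\<^sup>2 / (2 * \<theta>) + (d y)\<^sup>2 / (2 * \<theta>)))) / 2"
  proof (intro divide_right_mono sum_mono mult_left_mono w_nonneg)
    fix x y
    have "\<bar>f x - f y\<bar> * (d x + d y) / 2 \<le> \<theta> / 4 * (f x - f y)\<^sup>2 + (d x + d y)\<^sup>2 / (4 * \<theta>)"
    proof -
      have "0 \<le> (\<theta> * \<bar>f x - f y\<bar> - (d x + d y))\<^sup>2 / (4 * \<theta>)" using \<theta>2 by simp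
      also have "\<dots> = \<theta> / 4 * \<bar>f x - f y\<bar>\<^sup>2 + (d x + d y)\<^sup>2 / (4 * \<theta>) - \<bar>f x - f y\<bar> * (d x + d y) / 2"
        using \<theta>2 unfolding power2_diff by (simp add: field_simps power2_eq_square)
      finally show ?thesis by simp
    qed
    also have "(d x + d y)\<^sup>2 / (4 * \<theta>) \<le> (2 * (d x)\<^sup>2 + 2 * (d y)\<^sup>2) / (4 * \<theta>)"
    proof (rule divide_right_mono)
      have "0 \<le> (d x - d y)\<^sup>2" by simp
      then show "(d x + d y)\<^sup>2 \<le> 2 * (d x)\<^sup>2 + 2 * (d y)\<^sup>2"
        by (simp add: power2_eq_square algebra_simps)
    qed (use \<theta>2 in simp)
    also have "\<dots> = (d x)\<^sup>2 / (2 * \<theta>) + (d y)\<^sup>2 / (2 * \<theta>)"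
      using \<theta>2 by (simp add: field_simps)
    finally show "\<bar>h x - h y\<bar> \<le> (\<theta> + 1) / 4 * (f x - f y)\<^sup>2 + ((d x)\<^sup>2 / (2 * \<theta>) + (d y)\<^sup>2 / (2 * \<theta>))"
      using h_diff[of x y] by (simp add: add_divide_distrib distrib_right)
  qed simp
  also have "\<dots> = (\<theta> + 1) / 4 * energy f f
      + (\<Sum>x\<in>UNIV. \<Sum>y\<in>UNIV. w x y * ((d x)\<^sup>2 / (2 * \<theta>) + (d y)\<^sup>2 / (2 * \<theta>))) / 2"
  proof -
    have "(\<theta> + 1) / 4 * energy f f = (\<Sum>x\<in>UNIV. \<Sum>y\<in>UNIV. w x y * ((\<theta> + 1) / 4 * (f x - f y)\<^sup>2)) / 2"
      unfolding energy_def power2_eq_square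
      by (simp only: sum_distrib_left sum_divide_distrib times_divide_eq_right mult.left_commute)
    then show ?thesis by (simp only: distrib_left sum.distrib add_divide_distrib)
  qed
  also have "\<dots> \<le> (\<theta> + 1) / 4 * (r * N) + ?D * (\<Sum>x\<in>UNIV. \<mu> x * ((d x)\<^sup>2 / (2 * \<theta>)))"
    using \<theta>2 fr by (intro add_mono mult_left_mono sum_degree_le) (auto simp: N_def)
  also have "?D * (\<Sum>x\<in>UNIV. \<mu> x * ((d x)\<^sup>2 / (2 * \<theta>))) = ?D / (2 * \<theta>) * (\<Sum>x\<in>UNIV. \<mu> x * (d x)\<^sup>2)"
    by (simp add: sum_divide_distrib[symmetric])
  also have "\<dots> \<le> ?D / (2 * \<theta>) * (4 * r * N / ?L)"
    using d2 \<theta>2 lambda_le_2_D_non[OF k] pos by (intro mult_left_mono) auto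
  also have "\<dots> = (?D / ?L) * (2 * r * N / \<theta>)" using \<theta>2 by (simp add: field_simps)
  also have "\<dots> = \<theta> / 4 * (r * N)" unfolding \<theta>sq using \<theta>2 by (simp add: field_simps power2_eq_square)
  finally have "\<phi> * (\<Sum>x\<in>UNIV. \<mu> x * h x) \<le> (2 * \<theta> + 1) / 4 * (r * N)"
    by (simp add: algebra_simps add_divide_distrib)
  also have "\<dots> \<le> (5 / 8 * \<theta>) * (r * N)"
    using \<theta>2 r fN by (intro mult_right_mono) (auto simp: N_def)
  finally have up: "\<phi> * (\<Sum>x\<in>UNIV. \<mu> x * h x) \<le> (5 / 8 * \<theta>) * (r * N)" .
  have "N \<le> 8 * k * (\<Sum>x\<in>UNIV. \<mu> x * h x)"
  proof -
    have "N = (\<Sum>x\<in>UNIV. \<mu> x * (f x)\<^sup>2)" by (simp add: N_def ip_def power2_eq_square)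
    also have "\<dots> \<le> (\<Sum>x\<in>UNIV. \<mu> x * (8 * k * h x))"
      by (intro sum_mono mult_left_mono h_lower less_imp_le[OF \<mu>_pos])
    finally show ?thesis by (simp add: sum_distrib_left mult_ac)
  qed
  then have "\<phi> * N \<le> \<phi> * (8 * k * (\<Sum>x\<in>UNIV. \<mu> x * h x))" by (rule mult_left_mono[OF _ \<phi>0])
  also have "\<dots> = 8 * k * (\<phi> * (\<Sum>x\<in>UNIV. \<mu> x * h x))" by simp
  also have "\<dots> \<le> 8 * k * ((5 / 8 * \<theta>) * (r * N))" by (rule mult_left_mono[OF up]) simp
  also have "\<dots> = (5 * real k * \<theta> * r) * N" by simp
  finally show ?thesis using fN by (simp add: N_def \<theta>_def)
qed

text \<open>
  Truncating an eigenfunction at zero does not increase its Rayleigh quotient. Replacing the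
  eigenfunction by its negative if necessary, the positive part has the smaller support.
\<close>

lemma half_support_test_function:
  assumes f: "f \<noteq> (\<lambda>_. 0)" "ip (\<lambda>_. 1) f = 0" "\<And>x. Lap f x = - l * f x" and l: "0 < l"
  obtains g where "\<And>x. 0 \<le> g x" "0 < ip g g" "energy g g \<le> l * ip g g"
    "sum \<mu> {x. g x \<noteq> 0} \<le> sum \<mu> (- {x. g x \<noteq> 0})"
proof -
  have half: "\<exists>g. (\<forall>x. 0 \<le> g x) \<and> 0 < ip g g \<and> energy g g \<le> l * ip g g
      \<and> sum \<mu> {x. g x \<noteq> 0} \<le> sum \<mu> (- {x. g x \<noteq> 0})"
    if f: "f \<noteq> (\<lambda>_. 0)" "ip (\<lambda>_. 1) f = 0" "\<And>x. Lap f x = - l * f x"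
      and le: "sum \<mu> {x. 0 < f x} \<le> sum \<mu> {x. f x < 0}" for f
  proof -
    define g where "g x = max 0 (f x)" for x
    have "\<exists>x. 0 < f x"
    proof (rule ccontr)
      assume "\<not> ?thesis"
      then have "\<mu> x * (1 * f x) \<le> 0" for x
        using \<mu>_pos[of x] by (simp add: mult_le_0_iff not_less less_imp_le)
      moreover have "(\<Sum>x\<in>UNIV. - (\<mu> x * (1 * f x))) = 0" using f(2) by (simp add: ip_def sum_negf)
      ultimately have "\<forall>x\<in>UNIV. - (\<mu> x * (1 * f x)) = 0"
        by (subst (asm) sum_nonneg_eq_0_iff) auto
      then have "f x = 0" for x using \<mu>_pos[of x, THEN less_imp_neq] by auto
      then show False using f(1) by auto
    qed
    then obtain a where a: "0 < f a" by blast
    have supp: "{x. g x \<noteq> 0} = {x. 0 < f x}" by (auto simp: g_def)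
    have "energy g g \<le> energy g f"
      unfolding energy_def
    proof (intro divide_right_mono sum_mono mult_left_mono[OF _ w_nonneg])
      fix x y
      show "(g x - g y) * (g x - g y) \<le> (g x - g y) * (f x - f y)"
      proof -
        have "g x * (f x - g x) = 0" "g y * (f y - g y) = 0" by (auto simp: g_def max_def)
        moreover have "g x * (f y - g y) \<le> 0" "g y * (f x - g x) \<le> 0"
          by (rule mult_nonneg_nonpos; simp add: g_def)+
        moreover have "(g x - g y) * (f x - f y) - (g x - g y) * (g x - g y)
          = g x * (f x - g x) + g y * (f y - g y) - g x * (f y - g y) - g y * (f x - g x)"
          by (simp add: algebra_simps)
        ultimately show ?thesis by linarith
      qed
    qed simp
    also have "\<dots> = - ip g (Lap f)" by (simp add: ip_laplacian)
    also have "\<dots> = (\<Sum>x\<in>UNIV. l * (\<mu> x * (g x * f x)))"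
      unfolding ip_def sum_negf[symmetric] f(3) by (intro sum.cong) auto
    also have "\<dots> = (\<Sum>x\<in>UNIV. l * (\<mu> x * (g x * g x)))"
      by (intro sum.cong) (auto simp: g_def max_def)
    finally have "energy g g \<le> l * ip g g" by (simp add: ip_def sum_distrib_left)
    moreover have "0 < ip g g" by (rule ip_pos[of g a]) (use a in \<open>simp add: g_def\<close>)
    moreover have "sum \<mu> {x. g x \<noteq> 0} \<le> sum \<mu> (- {x. g x \<noteq> 0})"
    proof -
      have "sum \<mu> {x. f x < 0} \<le> sum \<mu> (- {x. 0 < f x})"
        by (rule sum_mono2) (auto simp: \<mu>_pos less_imp_le)
      then show ?thesis using le by (simp add: supp)
    qed
    moreover have "\<forall>x. 0 \<le> g x" by (simp add: g_def)
    ultimately show ?thesis by blast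
  qed
  have "\<exists>g. (\<forall>x. 0 \<le> g x) \<and> 0 < ip g g \<and> energy g g \<le> l * ip g g
      \<and> sum \<mu> {x. g x \<noteq> 0} \<le> sum \<mu> (- {x. g x \<noteq> 0})"
  proof (cases "sum \<mu> {x. 0 < f x} \<le> sum \<mu> {x. f x < 0}")
    case True
    then show ?thesis using half[OF f] by blast
  next
    case False
    have "(\<lambda>x. - f x) \<noteq> (\<lambda>_. 0)" using f(1) by (auto simp: fun_eq_iff)
    moreover have "ip (\<lambda>_. 1) (\<lambda>x. - f x) = 0" using f(2) by (simp add: ip_def sum_negf)
    moreover have "Lap (\<lambda>x. - f x) x = - l * - f x" for x
      using laplacian_scale[of "-1" f x] f(3)[of x] by simp
    ultimately show ?thesis using half[of "\<lambda>x. - f x"] False by simp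
  qed
  then show ?thesis using that by blast
qed

end

section \<open>The heat semigroup\<close>

text \<open>
  Used to differentiate \<open>s \<mapsto> heat s (F s) x\<close>, in which both the operator and the function vary: the
  expansion in the basis of point masses turns it into a finite sum of products.
\<close>

lemma linear_functional_eq_sum:
  fixes L :: "('v::finite \<Rightarrow> real) \<Rightarrow> real"
  assumes add: "\<And>f g. L (\<lambda>z. f z + g z) = L f + L g"
    and scale: "\<And>c f. L (\<lambda>z. c * f z) = c * L f"
  shows "L f = (\<Sum>y\<in>UNIV. f y * L (\<lambda>z. of_bool (z = y)))"
proof -
  have L0: "L (\<lambda>z. 0) = 0" using scale[of 0 "\<lambda>z. 0"] by simp
  define e :: "'v \<Rightarrow> 'v \<Rightarrow> real" where "e y z = of_bool (z = y)" for y z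
  have "L (\<lambda>z. \<Sum>y\<in>Y. f y * e y z) = (\<Sum>y\<in>Y. f y * L (e y))" if "finite Y" for Y
    using that
  proof (induction Y rule: finite_induct)
    case (insert a Y)
    then show ?case by (simp add: add scale)
  qed (simp add: L0)
  from this[of UNIV] show ?thesis by (simp add: e_def[abs_def])
qed

context weighted_graph
begin

text \<open>
  Adding \<open>D_non\<close> makes the diagonal of \<open>\<Delta>\<close> nonnegative, so that this operator, and with it all its
  powers, preserves pointwise inequalities.
\<close>

definition shifted_laplacian :: "('v \<Rightarrow> real) \<Rightarrow> 'v \<Rightarrow> real" where
  "shifted_laplacian f x = Lap f x + D_non E w \<mu> * f x"

lemma shifted_laplacian_eq:
  "shifted_laplacian f x
    = (\<Sum>y\<in>UNIV. w x y * f y) / \<mu> x + (D_non E w \<mu> - (\<Sum>y\<in>UNIV. w x y) / \<mu> x) * f x"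
proof -
  have "(\<Sum>y\<in>UNIV. w x y * (f y - f x)) = (\<Sum>y\<in>UNIV. w x y * f y) - (\<Sum>y\<in>UNIV. w x y) * f x"
    by (simp add: right_diff_distrib sum_subtractf sum_distrib_right)
  then show ?thesis
    by (simp only: shifted_laplacian_def laplacian_eq) (simp add: diff_divide_distrib left_diff_distrib)
qed

lemma shifted_laplacian_mono:
  assumes "\<And>y. f y \<le> g y"
  shows "shifted_laplacian f x \<le> shifted_laplacian g x"
  unfolding shifted_laplacian_eq
proof (intro add_mono divide_right_mono sum_mono mult_left_mono assms w_nonneg)
  show "0 \<le> D_non E w \<mu> - (\<Sum>y\<in>UNIV. w x y) / \<mu> x"
    using degree_le_D_non[of x] \<mu>_pos[of x] by (simp add: field_simps)
qed (simp add: \<mu>_pos less_imp_le)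

lemma shifted_laplacian_add:
  "shifted_laplacian (\<lambda>y. f y + g y) = (\<lambda>x. shifted_laplacian f x + shifted_laplacian g x)"
  by (rule ext) (simp add: shifted_laplacian_def laplacian_add algebra_simps)

lemma shifted_laplacian_scale:
  "shifted_laplacian (\<lambda>y. c * f y) = (\<lambda>x. c * shifted_laplacian f x)"
  by (rule ext) (simp add: shifted_laplacian_def laplacian_scale algebra_simps)

lemma shifted_laplacian_const: "shifted_laplacian (\<lambda>y. c) = (\<lambda>x. D_non E w \<mu> * c)"
  by (rule ext) (simp add: shifted_laplacian_def laplacian_const)

lemma funpow_shifted_laplacian_add:
  "(shifted_laplacian ^^ n) (\<lambda>y. f y + g y)
    = (\<lambda>x. (shifted_laplacian ^^ n) f x + (shifted_laplacian ^^ n) g x)"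
  by (induction n) (simp_all add: shifted_laplacian_add)

lemma funpow_shifted_laplacian_scale:
  "(shifted_laplacian ^^ n) (\<lambda>y. c * f y) = (\<lambda>x. c * (shifted_laplacian ^^ n) f x)"
  by (induction n) (simp_all add: shifted_laplacian_scale)

lemma funpow_shifted_laplacian_const:
  "(shifted_laplacian ^^ n) (\<lambda>y. c) = (\<lambda>x. D_non E w \<mu> ^ n * c)"
  by (induction n) (simp_all add: shifted_laplacian_const mult.assoc)

lemma funpow_shifted_laplacian_mono:
  assumes "\<And>y. f y \<le> g y"
  shows "(shifted_laplacian ^^ n) f x \<le> (shifted_laplacian ^^ n) g x"
  using assms by (induction n arbitrary: x) (simp_all add: shifted_laplacian_mono)

lemma D_non_nonneg: "0 \<le> D_non E w \<mu>"
proof -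
  have "0 \<le> (\<Sum>y\<in>UNIV. w undefined y)" by (intro sum_nonneg w_nonneg)
  also have "\<dots> \<le> D_non E w \<mu> * \<mu> undefined" by (rule degree_le_D_non)
  finally show ?thesis using \<mu>_pos[of undefined] by (simp add: zero_le_mult_iff)
qed

lemma funpow_shifted_laplacian_bound:
  assumes "\<And>y. \<bar>f y\<bar> \<le> K"
  shows "\<bar>(shifted_laplacian ^^ n) f x\<bar> \<le> D_non E w \<mu> ^ n * K"
proof -
  have "(shifted_laplacian ^^ n) f x \<le> (shifted_laplacian ^^ n) (\<lambda>_. K) x"
    "(shifted_laplacian ^^ n) (\<lambda>_. - K) x \<le> (shifted_laplacian ^^ n) f x"
    using assms by (auto intro!: funpow_shifted_laplacian_mono simp: abs_le_iff minus_le_iff)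
  then show ?thesis by (simp add: funpow_shifted_laplacian_const abs_le_iff)
qed

lemma sums_shifted_laplacian:
  assumes "\<And>y. (\<lambda>n. s n y) sums S y"
  shows "(\<lambda>n. shifted_laplacian (s n) x) sums shifted_laplacian S x"
  unfolding shifted_laplacian_def laplacian_eq
  by (intro sums_add sums_divide sums_sum sums_mult sums_diff assms)

text \<open>
  The semigroup \<open>exp (t \<Delta>)\<close>, written as \<open>exp (- t D_non)\<close> times the exponential series of the shifted
  Laplacian: then positivity for \<open>t \<ge> 0\<close> holds term by term.
\<close>

definition heat :: "real \<Rightarrow> ('v \<Rightarrow> real) \<Rightarrow> 'v \<Rightarrow> real" where
  "heat t f x = exp (- (D_non E w \<mu> * t)) * (\<Sum>n. (shifted_laplacian ^^ n) f x / fact n * t ^ n)"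

lemma summable_heat: "summable (\<lambda>n. (shifted_laplacian ^^ n) f x / fact n * t ^ n)"
proof (rule summable_comparison_test)
  define K where "K = Max (range (\<lambda>y. \<bar>f y\<bar>))"
  have K: "\<bar>f y\<bar> \<le> K" for y unfolding K_def by (rule Max_ge) auto
  have "norm ((shifted_laplacian ^^ n) f x / fact n * t ^ n)
      \<le> K * (inverse (fact n) * (D_non E w \<mu> * \<bar>t\<bar>) ^ n)" for n
  proof -
    have "norm ((shifted_laplacian ^^ n) f x / fact n * t ^ n)
        = \<bar>(shifted_laplacian ^^ n) f x\<bar> * (inverse (fact n) * \<bar>t\<bar> ^ n)"
      by (simp add: abs_mult power_abs divide_inverse)
    also have "\<dots> \<le> (D_non E w \<mu> ^ n * K) * (inverse (fact n) * \<bar>t\<bar> ^ n)"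
      by (rule mult_right_mono[OF funpow_shifted_laplacian_bound[OF K]]) simp
    finally show ?thesis by (simp add: power_mult_distrib mult_ac)
  qed
  then show "\<exists>N. \<forall>n\<ge>N. norm ((shifted_laplacian ^^ n) f x / fact n * t ^ n)
      \<le> K * (inverse (fact n) * (D_non E w \<mu> * \<bar>t\<bar>) ^ n)" by blast
  show "summable (\<lambda>n. K * (inverse (fact n) * (D_non E w \<mu> * \<bar>t\<bar>) ^ n))"
    by (intro summable_mult summable_exp)
qed

lemma heat_sums:
  "(\<lambda>n. exp (- (D_non E w \<mu> * t)) * ((shifted_laplacian ^^ n) f x / fact n * t ^ n)) sums heat t f x"
  unfolding heat_def by (intro sums_mult summable_sums summable_heat)

lemma heat_add: "heat t (\<lambda>y. f y + g y) x = heat t f x + heat t g x"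
proof (rule sums_unique2[OF heat_sums])
  show "(\<lambda>n. exp (- (D_non E w \<mu> * t))
      * ((shifted_laplacian ^^ n) (\<lambda>y. f y + g y) x / fact n * t ^ n)) sums (heat t f x + heat t g x)"
    using sums_add[OF heat_sums heat_sums, of t f x t g x]
    by (simp add: funpow_shifted_laplacian_add add_divide_distrib algebra_simps)
qed

lemma heat_scale: "heat t (\<lambda>y. c * f y) x = c * heat t f x"
proof (rule sums_unique2[OF heat_sums])
  show "(\<lambda>n. exp (- (D_non E w \<mu> * t))
      * ((shifted_laplacian ^^ n) (\<lambda>y. c * f y) x / fact n * t ^ n)) sums (c * heat t f x)"
    using sums_mult[OF heat_sums, of c t f x]
    by (simp add: funpow_shifted_laplacian_scale mult_ac)
qed

lemma heat_const: "heat t (\<lambda>y. c) x = c"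
proof -
  have "(\<lambda>n. c * ((D_non E w \<mu> * t) ^ n /\<^sub>R fact n)) sums (c * exp (D_non E w \<mu> * t))"
    by (intro sums_mult exp_converges)
  then have "(\<Sum>n. (shifted_laplacian ^^ n) (\<lambda>y. c) x / fact n * t ^ n) = c * exp (D_non E w \<mu> * t)"
    by (intro sums_unique[symmetric])
      (simp add: funpow_shifted_laplacian_const power_mult_distrib divide_inverse mult_ac)
  then show ?thesis by (simp add: heat_def exp_minus)
qed

lemma heat_0: "heat 0 f x = f x"
  using powser_zero[of "\<lambda>n. (shifted_laplacian ^^ n) f x / fact n"] by (simp add: heat_def)

lemma heat_nonneg:
  assumes "0 \<le> t" "\<And>y. 0 \<le> f y"
  shows "0 \<le> heat t f x"
  unfolding heat_def
proof (intro mult_nonneg_nonneg suminf_nonneg summable_heat divide_nonneg_nonneg)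
  fix n
  have "(shifted_laplacian ^^ n) (\<lambda>_. 0) x \<le> (shifted_laplacian ^^ n) f x"
    by (rule funpow_shifted_laplacian_mono) (rule assms(2))
  then show "0 \<le> (shifted_laplacian ^^ n) f x"
    by (simp add: funpow_shifted_laplacian_const)
qed (use assms in auto)

lemma heat_laplacian_eq:
  "heat t (Lap f) x = heat t (shifted_laplacian f) x - D_non E w \<mu> * heat t f x"
proof -
  have "shifted_laplacian f = (\<lambda>y. Lap f y + D_non E w \<mu> * f y)"
    by (rule ext) (simp add: shifted_laplacian_def)
  then show ?thesis by (simp add: heat_add heat_scale)
qed

lemma laplacian_heat: "Lap (heat t f) x = heat t (Lap f) x"
proof -
  have "(\<lambda>n. shifted_laplacian (\<lambda>y. exp (- (D_non E w \<mu> * t)) * ((shifted_laplacian ^^ n) f y / fact n * t ^ n)) x)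
      sums shifted_laplacian (heat t f) x"
    by (rule sums_shifted_laplacian) (rule heat_sums)
  moreover have "shifted_laplacian (\<lambda>y. exp (- (D_non E w \<mu> * t)) * ((shifted_laplacian ^^ n) f y / fact n * t ^ n)) x
    = exp (- (D_non E w \<mu> * t)) * ((shifted_laplacian ^^ n) (shifted_laplacian f) x / fact n * t ^ n)" for n
  proof -
    define a where "a = exp (- (D_non E w \<mu> * t)) * t ^ n / fact n"
    have "exp (- (D_non E w \<mu> * t)) * ((shifted_laplacian ^^ n) g y / fact n * t ^ n)
        = a * (shifted_laplacian ^^ n) g y" for g y
      by (simp add: a_def)
    then show ?thesis
      by (simp only: shifted_laplacian_scale) (simp add: funpow_swap1)
  qed
  ultimately have "shifted_laplacian (heat t f) x = heat t (shifted_laplacian f) x"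
    using heat_sums sums_unique2 by (simp only:) blast
  then show ?thesis by (simp add: heat_laplacian_eq shifted_laplacian_def)
qed

lemma has_derivative_heat:
  "((\<lambda>t. heat t f x) has_real_derivative heat t (Lap f) x) (at t)"
proof -
  define c where "c n = (shifted_laplacian ^^ n) f x / fact n" for n
  have diffs: "diffs c n = (shifted_laplacian ^^ n) (shifted_laplacian f) x / fact n" for n
    by (simp add: diffs_def c_def funpow_swap1 del: of_nat_Suc)
  have "((\<lambda>t. \<Sum>n. c n * t ^ n) has_real_derivative (\<Sum>n. diffs c n * t ^ n)) (at t)"
    by (rule termdiffs_strong_converges_everywhere) (unfold c_def, rule summable_heat)
  then have "((\<lambda>t. exp (- (D_non E w \<mu> * t)) * (\<Sum>n. c n * t ^ n)) has_real_derivative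
      - D_non E w \<mu> * (exp (- (D_non E w \<mu> * t)) * (\<Sum>n. c n * t ^ n))
      + exp (- (D_non E w \<mu> * t)) * (\<Sum>n. diffs c n * t ^ n)) (at t)"
    by (auto intro!: derivative_eq_intros)
  then show ?thesis
    unfolding heat_laplacian_eq by (simp add: heat_def c_def diffs)
qed

lemma has_derivative_heat_comp:
  assumes "\<And>y. ((\<lambda>s. F s y) has_real_derivative F' y) (at s)"
  shows "((\<lambda>s. heat s (F s) x) has_real_derivative heat s (\<lambda>y. F' y + Lap (F s) y) x) (at s)"
proof -
  have rep: "heat s f x = (\<Sum>y\<in>UNIV. f y * heat s (\<lambda>z. of_bool (z = y)) x)" for s f
    by (rule linear_functional_eq_sum) (simp_all add: heat_add heat_scale)
  have rep_lap: "heat s (Lap f) x = (\<Sum>y\<in>UNIV. f y * heat s (Lap (\<lambda>z. of_bool (z = y))) x)" for f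
  proof (rule linear_functional_eq_sum)
    show "heat s (Lap (\<lambda>z. f z + g z)) x = heat s (Lap f) x + heat s (Lap g) x" for f g
      using heat_add[of s "Lap f" "Lap g" x] by (simp add: laplacian_add[abs_def])
    show "heat s (Lap (\<lambda>z. c * f z)) x = c * heat s (Lap f) x" for c f
      using heat_scale[of s c "Lap f" x] by (simp add: laplacian_scale[abs_def])
  qed
  have "((\<lambda>s. \<Sum>y\<in>UNIV. F s y * heat s (\<lambda>z. of_bool (z = y)) x) has_real_derivative
      (\<Sum>y\<in>UNIV. F' y * heat s (\<lambda>z. of_bool (z = y)) x + heat s (Lap (\<lambda>z. of_bool (z = y))) x * F s y)) (at s)"
    by (intro DERIV_sum DERIV_mult assms has_derivative_heat)
  moreover have "(\<Sum>y\<in>UNIV. F' y * heat s (\<lambda>z. of_bool (z = y)) x + heat s (Lap (\<lambda>z. of_bool (z = y))) x * F s y)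
    = heat s (\<lambda>y. F' y + Lap (F s) y) x"
    unfolding heat_add rep[of s F'] rep_lap[of "F s"] by (simp add: sum.distrib mult.commute)
  ultimately show ?thesis by (simp add: rep[symmetric])
qed

lemma has_derivative_heat_backwards:
  "((\<lambda>s. heat (t - s) g y) has_real_derivative - Lap (heat (t - s) g) y) (at s)"
proof -
  have "((\<lambda>s. t - s) has_real_derivative -1) (at s)" by (auto intro!: derivative_eq_intros)
  from DERIV_chain2[OF has_derivative_heat this] show ?thesis by (simp add: laplacian_heat)
qed

end

section \<open>The Buser inequality\<close>

context weighted_graph
begin

text \<open>
  The function \<open>\<psi> s = P\<^sub>s ((P\<^sub>t\<^sub>-\<^sub>s g)\<^sup>2)\<close> interpolates between \<open>(P\<^sub>t g)\<^sup>2\<close> and \<open>P\<^sub>t (g\<^sup>2)\<close>. Its first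
  derivative is \<open>2 P\<^sub>s \<Gamma>(P\<^sub>t\<^sub>-\<^sub>s g)\<close> and its second derivative is \<open>4 P\<^sub>s \<Gamma>\<^sub>2(P\<^sub>t\<^sub>-\<^sub>s g)\<close>, which is
  nonnegative by the curvature condition. So \<open>\<psi> t - \<psi> 0\<close> is at least \<open>t\<close> times the derivative
  at zero.
\<close>

lemma gradient_estimate:
  assumes CD: "CD_zero_infinity E w \<mu>" and t: "0 < t"
  shows "2 * t * \<Gamma> (heat t g) (heat t g) x \<le> heat t (\<lambda>y. g y * g y) x - heat t g x * heat t g x"
proof -
  define u where "u s = heat (t - s) g" for s
  have du: "((\<lambda>s. u s y) has_real_derivative - Lap (u s) y) (at s)" for s y
    unfolding u_def by (rule has_derivative_heat_backwards)
  define \<psi> where "\<psi> s = heat s (\<lambda>y. u s y * u s y) x" for s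
  define \<eta> where "\<eta> s = heat s (\<lambda>y. \<Gamma> (u s) (u s) y) x" for s
  have d\<psi>: "(\<psi> has_real_derivative 2 * \<eta> s) (at s)" for s
  proof -
    have "((\<lambda>s. u s y * u s y) has_real_derivative - Lap (u s) y * u s y + - Lap (u s) y * u s y) (at s)" for y
      by (intro DERIV_mult du)
    then have "(\<psi> has_real_derivative heat s (\<lambda>y. (- Lap (u s) y * u s y + - Lap (u s) y * u s y)
        + Lap (\<lambda>y. u s y * u s y) y) x) (at s)"
      unfolding \<psi>_def by (rule has_derivative_heat_comp)
    moreover have "(- Lap (u s) y * u s y + - Lap (u s) y * u s y) + Lap (\<lambda>y. u s y * u s y) y
        = 2 * \<Gamma> (u s) (u s) y" for y
      by (simp add: Gam_def algebra_simps)
    ultimately show ?thesis by (simp add: \<eta>_def heat_scale)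
  qed
  have d\<eta>: "(\<eta> has_real_derivative 2 * heat s (Gam2 E w \<mu> (u s) (u s)) x) (at s)" for s
  proof -
    have "((\<lambda>s. \<Gamma> (u s) (u s) y) has_real_derivative - 2 * \<Gamma> (u s) (Lap (u s)) y) (at s)" for y
    proof -
      have "((\<lambda>s. (\<Sum>z\<in>UNIV. w y z * ((u s z - u s y) * (u s z - u s y))) / (2 * \<mu> y)) has_real_derivative
        (\<Sum>z\<in>UNIV. w y z * ((- Lap (u s) z - - Lap (u s) y) * (u s z - u s y)
           + (- Lap (u s) z - - Lap (u s) y) * (u s z - u s y))) / (2 * \<mu> y)) (at s)"
        by (intro DERIV_cdivide DERIV_sum DERIV_cmult DERIV_mult DERIV_diff du)
      moreover have "(\<Sum>z\<in>UNIV. w y z * ((- Lap (u s) z - - Lap (u s) y) * (u s z - u s y)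
           + (- Lap (u s) z - - Lap (u s) y) * (u s z - u s y))) / (2 * \<mu> y)
         = - 2 * \<Gamma> (u s) (Lap (u s)) y"
        unfolding Gam_eq times_divide_eq_right sum_distrib_left
        by (intro arg_cong[where f = "\<lambda>a. a / (2 * \<mu> y)"] sum.cong) (auto simp: algebra_simps)
      ultimately show ?thesis by (simp only: Gam_eq[of "u s" "u s" for s])
    qed
    then have "(\<eta> has_real_derivative heat s (\<lambda>y. - 2 * \<Gamma> (u s) (Lap (u s)) y
        + Lap (\<lambda>y. \<Gamma> (u s) (u s) y) y) x) (at s)"
      unfolding \<eta>_def by (rule has_derivative_heat_comp)
    moreover have "- 2 * \<Gamma> (u s) (Lap (u s)) y + Lap (\<lambda>y. \<Gamma> (u s) (u s) y) y
        = 2 * Gam2 E w \<mu> (u s) (u s) y" for y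
      by (simp add: Gam2_def)
    ultimately show ?thesis by (simp add: heat_scale)
  qed
  obtain z where z: "0 < z" "z < t" "\<psi> t - \<psi> 0 = (t - 0) * (2 * \<eta> z)"
    using MVT2[OF t, of \<psi> "\<lambda>s. 2 * \<eta> s"] d\<psi> by blast
  have "\<eta> 0 \<le> \<eta> z"
  proof (rule DERIV_nonneg_imp_nondecreasing[where f = \<eta>])
    fix s assume s: "0 \<le> s" "s \<le> z"
    have "0 \<le> heat s (Gam2 E w \<mu> (u s) (u s)) x"
      using CD s by (intro heat_nonneg) (auto simp: CD_zero_infinity_def)
    then show "\<exists>d. DERIV \<eta> s :> d \<and> 0 \<le> d"
      by (intro exI[of _ "2 * heat s (Gam2 E w \<mu> (u s) (u s)) x"] conjI d\<eta>) simp
  qed (use z in simp)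
  then have "t * (2 * \<eta> 0) \<le> \<psi> t - \<psi> 0" using z t by simp
  then show ?thesis by (simp add: \<psi>_def \<eta>_def u_def heat_0)
qed

text \<open>
  For an indicator function \<open>g\<^sup>2 = g\<close>, so the right-hand side of the gradient estimate is \<open>u - u\<^sup>2\<close>
  with \<open>u = P\<^sub>t g\<close>, which is at most \<open>1 / 4\<close>. On the left, the square of the difference of
  \<open>u\<close> along an edge at \<open>x\<close> is at most \<open>2 * D_nor * \<Gamma> u u x\<close>.
\<close>

lemma heat_indicator_lipschitz:
  assumes CD: "CD_zero_infinity E w \<mu>" and t: "0 < t" and ne: "\<And>x. \<exists>y. (x, y) \<in> E"
    and xy: "(x, y) \<in> E"
  shows "\<bar>heat t (\<lambda>z. of_bool (z \<in> S)) x - heat t (\<lambda>z. of_bool (z \<in> S)) y\<bar>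
    \<le> sqrt (D_nor E w \<mu>) / (2 * sqrt t)"
proof -
  define u where "u = heat t (\<lambda>z. of_bool (z \<in> S))"
  have wp: "0 < w x y" using w_pos_iff xy by simp
  have "w x y * ((u y - u x) * (u y - u x)) \<le> (\<Sum>z\<in>UNIV. w x z * ((u z - u x) * (u z - u x)))"
    by (rule member_le_sum) (auto simp: w_nonneg)
  also have "\<dots> = 2 * \<mu> x * \<Gamma> u u x"
    unfolding Gam_eq using \<mu>_pos[of x] by simp
  finally have 1: "w x y * ((u y - u x) * (u y - u x)) \<le> 2 * \<mu> x * \<Gamma> u u x" .
  have "2 * t * \<Gamma> u u x \<le> u x - u x * u x"
  proof -
    have "(of_bool (z \<in> S) :: real) * of_bool (z \<in> S) = of_bool (z \<in> S)" for z by simp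
    then show ?thesis
      using gradient_estimate[OF CD t, of "\<lambda>z. of_bool (z \<in> S)" x] by (simp only: u_def)
  qed
  also have "\<dots> \<le> 1 / 4"
  proof -
    have "0 \<le> (u x - 1 / 2)\<^sup>2" by simp
    then show ?thesis by (simp add: power2_eq_square algebra_simps)
  qed
  finally have 2: "\<Gamma> u u x \<le> 1 / (8 * t)" using t by (simp add: field_simps)
  have "w x y * ((u y - u x) * (u y - u x)) \<le> 2 * \<mu> x * (1 / (8 * t))"
    using 1 mult_left_mono[OF 2, of "2 * \<mu> x"] \<mu>_pos[of x] by linarith
  also have "\<dots> \<le> 2 * (D_nor E w \<mu> * w x y) * (1 / (8 * t))"
    using D_nor_bound[OF xy ne] t by (intro mult_right_mono mult_left_mono) auto
  also have "\<dots> = w x y * (D_nor E w \<mu> / (4 * t))" by simp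
  finally have "(u y - u x) * (u y - u x) \<le> D_nor E w \<mu> / (4 * t)"
    using wp by (rule mult_left_le_imp_le)
  then have "(u x - u y)\<^sup>2 \<le> D_nor E w \<mu> / (4 * t)"
    by (simp add: power2_eq_square algebra_simps)
  then have "\<bar>u x - u y\<bar> \<le> sqrt (D_nor E w \<mu> / (4 * t))"
    by (simp add: real_le_rsqrt)
  then show ?thesis by (simp add: u_def real_sqrt_divide real_sqrt_mult)
qed

lemma has_derivative_ip_heat:
  "((\<lambda>s. ip f (heat s g)) has_real_derivative - energy f (heat s g)) (at s)"
proof -
  have "((\<lambda>s. ip f (heat s g)) has_real_derivative (\<Sum>x\<in>UNIV. \<mu> x * (f x * heat s (Lap g) x))) (at s)"
    unfolding ip_def by (intro DERIV_sum DERIV_cmult has_derivative_heat)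
  moreover have "(\<Sum>x\<in>UNIV. \<mu> x * (f x * heat s (Lap g) x)) = ip f (Lap (heat s g))"
    by (simp add: ip_def laplacian_heat)
  ultimately show ?thesis by (simp add: ip_laplacian)
qed

text \<open>
  The rate at which heat leaves \<open>S\<close> at time \<open>s\<close> is at most the boundary weight times the Lipschitz bound
  \<open>sqrt D_nor / (2 * sqrt s)\<close>, whose integral from \<open>0\<close> to \<open>t\<close> is \<open>sqrt (D_nor * t)\<close>.
\<close>

lemma heat_flow_out_le:
  assumes CD: "CD_zero_infinity E w \<mu>" and t: "0 < t" and ne: "\<And>x. \<exists>y. (x, y) \<in> E"
  defines "b \<equiv> \<lambda>S x. of_bool (x \<in> S) :: real"
  shows "ip (b S) (b S) - ip (b S) (heat t (b S)) \<le> sqrt (D_nor E w \<mu>) * sqrt t * boundary_weight E w S"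
proof -
  define G where "G s = ip (b S) (heat s (b S)) + sqrt (D_nor E w \<mu>) * boundary_weight E w S * sqrt s" for s
  have dG: "(G has_real_derivative - energy (b S) (heat s (b S))
      + sqrt (D_nor E w \<mu>) * boundary_weight E w S * (inverse (sqrt s) / 2)) (at s)" if "0 < s" for s
    unfolding G_def by (intro DERIV_add has_derivative_ip_heat DERIV_cmult DERIV_real_sqrt that)
  have nonneg: "0 \<le> - energy (b S) (heat s (b S))
      + sqrt (D_nor E w \<mu>) * boundary_weight E w S * (inverse (sqrt s) / 2)" if s: "0 < s" for s
  proof -
    define K where "K = sqrt (D_nor E w \<mu>) / (2 * sqrt s)"
    have "energy (b S) (heat s (b S))
      \<le> (\<Sum>x\<in>UNIV. \<Sum>y\<in>UNIV. w x y * (K * ((b S x - b S y) * (b S x - b S y)))) / 2"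
      unfolding energy_def
    proof (intro divide_right_mono sum_mono)
      fix x y
      show "w x y * ((b S x - b S y) * (heat s (b S) x - heat s (b S) y))
        \<le> w x y * (K * ((b S x - b S y) * (b S x - b S y)))"
      proof (cases "(x, y) \<in> E")
        case True
        have "\<bar>heat s (b S) x - heat s (b S) y\<bar> \<le> K"
          using heat_indicator_lipschitz[OF CD s ne True, of S] by (simp add: K_def b_def)
        then have "(b S x - b S y) * (heat s (b S) x - heat s (b S) y)
            \<le> K * ((b S x - b S y) * (b S x - b S y))"
          unfolding b_def by (auto simp: abs_le_iff)
        then show ?thesis by (rule mult_left_mono[OF _ w_nonneg])
      qed (simp add: w_eq_0)
    qed simp
    also have "\<dots> = K * boundary_weight E w S"
      unfolding boundary_weight_eq_energy energy_def b_def
      by (simp only: sum_distrib_left times_divide_eq_right mult.left_commute)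
    finally show ?thesis by (simp add: K_def field_simps)
  qed
  have cont: "continuous_on {0..t} G"
  proof -
    have "continuous_on {0..t} (\<lambda>s. ip (b S) (heat s (b S)))"
      by (rule DERIV_continuous_on[OF has_field_derivative_at_within[OF has_derivative_ip_heat]])
    then show ?thesis unfolding G_def by (intro continuous_intros)
  qed
  obtain l z where z: "0 < z" "z < t" "DERIV G z :> l" "G t - G 0 = (t - 0) * l"
    using MVT[OF t cont] dG real_differentiable_def by blast
  have "l = - energy (b S) (heat z (b S))
      + sqrt (D_nor E w \<mu>) * boundary_weight E w S * (inverse (sqrt z) / 2)"
    by (rule DERIV_unique[OF z(3) dG[OF z(1)]])
  then have "0 \<le> G t - G 0" using nonneg[OF z(1)] z(4) t by simp
  moreover have "heat 0 (b S) = b S" by (rule ext) (rule heat_0)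
  ultimately show ?thesis by (simp add: G_def mult_ac)
qed

lemma ip_one_heat: "ip (\<lambda>_. 1) (heat t f) = ip (\<lambda>_. 1) f"
proof -
  have "((\<lambda>s. ip (\<lambda>_. 1) (heat s f)) has_real_derivative 0) (at s)" for s
    using has_derivative_ip_heat[of "\<lambda>_. 1" f s] by (simp add: energy_def)
  then have "ip (\<lambda>_. 1) (heat t f) = ip (\<lambda>_. 1) (heat 0 f)"
    using DERIV_isconst_all by blast
  moreover have "heat 0 f = f" by (rule ext) (rule heat_0)
  ultimately show ?thesis by simp
qed

text \<open>
  By self-adjointness \<open>s \<mapsto> ip (P\<^sub>s f) (P\<^sub>t\<^sub>-\<^sub>s f)\<close> has derivative zero; compare \<open>s = 0\<close> with \<open>s = t / 2\<close>.
\<close>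

lemma ip_heat_half: "ip f (heat t f) = ip (heat (t / 2) f) (heat (t / 2) f)"
proof -
  have "((\<lambda>s. ip (heat s f) (heat (t - s) f)) has_real_derivative 0) (at s)" for s
  proof -
    have "((\<lambda>s. ip (heat s f) (heat (t - s) f)) has_real_derivative
      (\<Sum>x\<in>UNIV. \<mu> x * (heat s (Lap f) x * heat (t - s) f x + - Lap (heat (t - s) f) x * heat s f x))) (at s)"
      unfolding ip_def
      by (intro DERIV_sum DERIV_cmult DERIV_mult has_derivative_heat has_derivative_heat_backwards)
    also have "(\<Sum>x\<in>UNIV. \<mu> x * (heat s (Lap f) x * heat (t - s) f x + - Lap (heat (t - s) f) x * heat s f x))
      = ip (Lap (heat s f)) (heat (t - s) f) - ip (heat s f) (Lap (heat (t - s) f))"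
      by (simp add: ip_def laplacian_heat algebra_simps sum_subtractf)
    finally show ?thesis by (simp add: ip_laplacian_commute)
  qed
  then have "ip (heat 0 f) (heat (t - 0) f) = ip (heat (t / 2) f) (heat (t - t / 2) f)"
    using DERIV_isconst_all by blast
  moreover have "heat 0 f = f" by (rule ext) (rule heat_0)
  ultimately show ?thesis by simp
qed

lemma heat_decay:
  assumes gap: "\<And>g. ip (\<lambda>_. 1) g = 0 \<Longrightarrow> l * ip g g \<le> energy g g"
    and f: "ip (\<lambda>_. 1) f = 0" and t: "0 \<le> t"
  shows "ip f (heat t f) \<le> exp (- (l * t)) * ip f f"
proof -
  \<comment> \<open>The gap makes the squared norm decay at rate \<open>2 * l\<close>, so \<open>F\<close> is nonincreasing.\<close>
  define F where "F s = exp (2 * l * s) * ip (heat s f) (heat s f)" for s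
  have "F (t / 2) \<le> F 0"
  proof (rule DERIV_nonpos_imp_nonincreasing[where f = F])
    fix s
    have "((\<lambda>s. ip (heat s f) (heat s f)) has_real_derivative
      (\<Sum>x\<in>UNIV. \<mu> x * (heat s (Lap f) x * heat s f x + heat s (Lap f) x * heat s f x))) (at s)"
      unfolding ip_def by (intro DERIV_sum DERIV_cmult DERIV_mult has_derivative_heat)
    also have "(\<Sum>x\<in>UNIV. \<mu> x * (heat s (Lap f) x * heat s f x + heat s (Lap f) x * heat s f x))
      = 2 * ip (heat s f) (Lap (heat s f))"
      by (simp add: ip_def laplacian_heat sum_distrib_left mult_ac)
    finally have d: "((\<lambda>s. ip (heat s f) (heat s f)) has_real_derivative
        - 2 * energy (heat s f) (heat s f)) (at s)"
      by (simp add: ip_laplacian)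
    have "(F has_real_derivative exp (2 * l * s) * (2 * l) * ip (heat s f) (heat s f)
        + - 2 * energy (heat s f) (heat s f) * exp (2 * l * s)) (at s)"
      unfolding F_def by (rule DERIV_mult[OF _ d]) (auto intro!: derivative_eq_intros)
    moreover have "exp (2 * l * s) * (2 * l) * ip (heat s f) (heat s f)
        + - 2 * energy (heat s f) (heat s f) * exp (2 * l * s)
      = 2 * exp (2 * l * s) * (l * ip (heat s f) (heat s f) - energy (heat s f) (heat s f))"
      by (simp add: algebra_simps)
    moreover have "\<dots> \<le> 0"
      using gap[of "heat s f"] by (simp add: ip_one_heat f mult_le_0_iff)
    ultimately show "\<exists>d. DERIV F s :> d \<and> d \<le> 0" by metis
  qed (use t in simp)
  moreover have "heat 0 f = f" by (rule ext) (rule heat_0)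
  ultimately have "exp (l * t) * ip (heat (t / 2) f) (heat (t / 2) f) \<le> ip f f"
    by (simp add: F_def)
  then show ?thesis unfolding ip_heat_half[of f t]
    by (simp add: exp_minus field_simps)
qed

text \<open>
  Only the deviation \<open>f\<close> of the indicator function from its mean \<open>c\<close> decays, and
  \<open>ip f f = \<mu>(S) * (1 - c)\<close> with \<open>c \<le> 1 / 2\<close>.
\<close>

lemma heat_flow_out_ge:
  assumes gap: "\<And>g. ip (\<lambda>_. 1) g = 0 \<Longrightarrow> l * ip g g \<le> energy g g"
    and l: "0 < l" and t: "0 \<le> t" and half: "sum \<mu> S \<le> sum \<mu> (- S)"
  defines "b \<equiv> \<lambda>x. of_bool (x \<in> S) :: real"
  shows "(1 - exp (- (l * t))) * (sum \<mu> S / 2) \<le> ip b b - ip b (heat t b)"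
proof -
  define V where "V = sum \<mu> UNIV"
  have V: "0 < V" unfolding V_def by (rule measure_pos) simp
  have VS: "V = sum \<mu> S + sum \<mu> (- S)"
    unfolding V_def by (subst sum.union_disjoint[symmetric]) auto
  define c where "c = sum \<mu> S / V"
  have c: "c \<le> 1 / 2" using half V VS by (simp add: c_def field_simps)
  define f where "f x = b x - c" for x
  have ipb: "ip b g = (\<Sum>x\<in>S. \<mu> x * g x)" for g
  proof -
    have "ip b g = (\<Sum>x\<in>UNIV. if x \<in> S then \<mu> x * g x else 0)"
      unfolding ip_def b_def by (intro sum.cong) auto
    then show ?thesis by (simp add: sum.If_cases)
  qed
  have ip_f: "ip f g = ip b g - c * ip (\<lambda>_. 1) g" for g
    by (simp add: ip_def f_def algebra_simps sum_subtractf sum_distrib_left)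
  have "ip (\<lambda>_. 1) b = sum \<mu> S"
    using ipb[of "\<lambda>_. 1"] by (simp add: ip_commute)
  then have mean: "ip (\<lambda>_. 1) f = 0"
    using V ip_f[of "\<lambda>_. 1"] ipb[of "\<lambda>_. 1"]
    by (simp add: ip_commute[of f] ip_def V_def c_def)
  have bb: "ip b b - ip b (heat t b) = ip f f - ip f (heat t f)"
  proof -
    have "b = (\<lambda>x. f x + c)" by (rule ext) (simp add: f_def)
    then have "heat t b x = heat t f x + c" for x
      by (simp add: heat_add heat_const)
    then have "ip b b - ip b (heat t b) = ip b f - ip b (heat t f)"
      by (simp add: ip_def f_def algebra_simps sum_subtractf sum.distrib)
    then show ?thesis by (simp add: ip_f mean ip_one_heat)
  qed
  have ff: "ip f f = sum \<mu> S * (1 - c)"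
    using ipb[of f] by (simp add: ip_f[of f] mean f_def b_def sum_distrib_right)
  have "(1 - exp (- (l * t))) * (sum \<mu> S / 2) \<le> (1 - exp (- (l * t))) * ip f f"
  proof (rule mult_left_mono)
    have "sum \<mu> S * (1 / 2) \<le> sum \<mu> S * (1 - c)"
      using c by (intro mult_left_mono sum_nonneg) (auto simp: \<mu>_pos less_imp_le)
    then show "sum \<mu> S / 2 \<le> ip f f" by (simp add: ff)
  qed (use l t in simp)
  also have "\<dots> \<le> ip f f - ip f (heat t f)"
    using heat_decay[OF gap mean t] by (simp add: algebra_simps)
  finally show ?thesis by (simp add: bb)
qed

text \<open>
  Compare the two bounds on the heat leaving an optimal set at time \<open>1 / l\<close>.
\<close>

lemma buser:
  assumes CD: "CD_zero_infinity E w \<mu>" and card: "2 \<le> CARD('v)"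
    and gap: "\<And>g. ip (\<lambda>_. 1) g = 0 \<Longrightarrow> l * ip g g \<le> energy g g" and l: "0 < l"
  shows "(1 - exp (-1)) * sqrt l \<le> 2 * sqrt (D_nor E w \<mu>) * cheeger E w \<mu> 2"
proof -
  obtain S where S: "S \<noteq> {}" "S \<noteq> UNIV" "sum \<mu> S \<le> sum \<mu> (- S)"
    "boundary_weight E w S \<le> cheeger E w \<mu> 2 * sum \<mu> S"
    by (rule cheeger_2_attained[OF card])
  obtain a b where "(a, b) \<in> E" using exists_neighbour[OF card] by blast
  then have "\<mu> a \<le> D_nor E w \<mu> * w a b" by (rule D_nor_bound) (rule exists_neighbour[OF card])
  then have Dn: "0 \<le> D_nor E w \<mu>"
    using \<mu>_pos[of a] w_nonneg[of a b] by (smt (verit) mult_nonneg_nonneg mult_nonpos_nonneg)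
  have lt: "l * (1 / l) = 1" using l by simp
  have "(1 - exp (- (l * (1 / l)))) * (sum \<mu> S / 2)
    \<le> sqrt (D_nor E w \<mu>) * sqrt (1 / l) * boundary_weight E w S"
    using heat_flow_out_ge[OF gap l _ S(3), of "1 / l"] 
      heat_flow_out_le[OF CD _ exists_neighbour[OF card], of "1 / l" S] l by simp
  also have "\<dots> \<le> sqrt (D_nor E w \<mu>) * sqrt (1 / l) * (cheeger E w \<mu> 2 * sum \<mu> S)"
    using S(4) Dn l by (intro mult_left_mono) auto
  finally have "((1 - exp (-1)) / 2) * sum \<mu> S
      \<le> (sqrt (D_nor E w \<mu>) * sqrt (1 / l) * cheeger E w \<mu> 2) * sum \<mu> S"
    unfolding lt by (simp add: mult_ac)
  then have "(1 - exp (-1)) / 2 \<le> sqrt (D_nor E w \<mu>) * sqrt (1 / l) * cheeger E w \<mu> 2"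
    using measure_pos[OF S(1)] by (rule mult_right_le_imp_le)
  then show ?thesis using l by (simp add: real_sqrt_divide field_simps)
qed

end

theorem corollaryC:
  fixes E :: "('v::finite \<times> 'v) set"
    and w :: "'v \<Rightarrow> 'v \<Rightarrow> real"
    and \<mu> :: "'v \<Rightarrow> real"
    and k :: nat
  assumes "weighted_graph E w \<mu>"
    and "CD_zero_infinity E w \<mu>"
    and "2 \<le> k" and "k \<le> CARD('v)"
  shows "cheeger E w \<mu> k \<ge> cheeger E w \<mu> 2 \<and>
    cheeger E w \<mu> 2 \<ge>
      (exp 1 - 1)\<^sup>2 / (40 * sqrt 2 * (exp 1)\<^sup>2)
        * (1 / (D_nor E w \<mu> * sqrt (D_non E w \<mu>)))
        * (sqrt (lambda E w \<mu> k) / real k)"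
proof
  interpret weighted_graph E w \<mu> by fact
  show "cheeger E w \<mu> 2 \<le> cheeger E w \<mu> k" by (rule cheeger_2_le_cheeger) fact+
  have card: "2 \<le> CARD('v)" using assms by linarith
  define Dn D L h where "Dn = D_nor E w \<mu>" and "D = D_non E w \<mu>"
    and "L = lambda E w \<mu> k" and "h = cheeger E w \<mu> 2"
  have h: "0 < h" unfolding h_def by (rule cheeger_2_pos[OF card])
  obtain a b where ab: "(a, b) \<in> E" using exists_neighbour[OF card] by blast
  have wab: "0 < w a b" using ab w_pos_iff by simp
  have "\<mu> a \<le> Dn * w a b" unfolding Dn_def
    by (rule D_nor_bound[OF ab]) (rule exists_neighbour[OF card])
  then have Dn: "0 < Dn" using \<mu>_pos[of a] wab
    by (metis less_le_trans zero_less_mult_pos2)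
  have "(exp 1 - 1)\<^sup>2 / (40 * sqrt 2 * (exp 1)\<^sup>2) * (1 / (Dn * sqrt D)) * (sqrt L / real k) \<le> h"
  proof (cases "0 < L")
    case False
    have "(exp 1 - 1)\<^sup>2 / (40 * sqrt 2 * (exp 1)\<^sup>2) * (1 / (Dn * sqrt D)) * (sqrt L / real k) \<le> 0"
      using False Dn D_non_nonneg
      by (intro mult_nonneg_nonpos mult_nonneg_nonneg divide_nonpos_nonneg) (auto simp: D_def)
    then show ?thesis using h by linarith
  next
    case True
    have k1: "1 \<le> k" using assms by simp
    obtain l f where lf: "0 < l" "f \<noteq> (\<lambda>_. 0)" "ip (\<lambda>_. 1) f = 0" "\<And>x. Lap f x = - l * f x"
      and gap: "\<And>g. ip (\<lambda>_. 1) g = 0 \<Longrightarrow> l * ip g g \<le> energy g g"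
      using spectral_gap[OF card] by metis
    obtain g where g: "\<And>x. 0 \<le> g x" "0 < ip g g" "energy g g \<le> l * ip g g"
      "sum \<mu> {x. g x \<noteq> 0} \<le> sum \<mu> (- {x. g x \<noteq> 0})"
      using half_support_test_function[OF lf(2-4,1)] by metis
    define \<theta> where "\<theta> = sqrt (8 * D / L)"
    have upper: "h \<le> 5 * real k * \<theta> * l"
      unfolding \<theta>_def D_def L_def
    proof (rule improved_cheeger[of k g])
      fix S assume S: "S \<noteq> {}" "S \<subseteq> {x. g x \<noteq> 0}"
      have "sum \<mu> S \<le> sum \<mu> {x. g x \<noteq> 0}"
        by (rule sum_mono2) (use S \<mu>_pos less_imp_le in auto)
      also have "\<dots> \<le> sum \<mu> (- {x. g x \<noteq> 0})" by (rule g(4))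
      also have "\<dots> \<le> sum \<mu> (- S)"
        by (rule sum_mono2) (use S \<mu>_pos less_imp_le in auto)
      finally show "h * sum \<mu> S \<le> boundary_weight E w S"
        unfolding h_def by (rule cheeger_2_le[OF S(1)])
    qed (use k1 assms True g lf h in \<open>auto simp: L_def\<close>)
    define p :: real where "p = 1 - exp (-1)"
    have p: "0 < p" by (simp add: p_def)
    have "p * sqrt l \<le> 2 * sqrt Dn * h"
      unfolding p_def Dn_def h_def by (rule buser[OF assms(2) card gap lf(1)])
    then have "(p * sqrt l)\<^sup>2 \<le> (2 * sqrt Dn * h)\<^sup>2"
      using p lf by (intro power_mono) auto
    then have lower: "p\<^sup>2 * l \<le> 4 * Dn * h\<^sup>2"
      using lf Dn by (simp add: power_mult_distrib)
    have D: "0 < D"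
      using lambda_le_2_D_non[OF k1] assms True by (simp add: L_def D_def)
    then have \<theta>: "0 < \<theta>" using True by (simp add: \<theta>_def)
    have "p\<^sup>2 * h \<le> p\<^sup>2 * (5 * real k * \<theta> * l)" using upper by (intro mult_left_mono) auto
    also have "\<dots> = 5 * real k * \<theta> * (p\<^sup>2 * l)" by simp
    also have "\<dots> \<le> 5 * real k * \<theta> * (4 * Dn * h\<^sup>2)" using lower \<theta> by (intro mult_left_mono) auto
    also have "\<dots> = (20 * real k * \<theta> * Dn * h) * h" by (simp add: power2_eq_square)
    finally have main: "p\<^sup>2 \<le> 20 * real k * \<theta> * Dn * h" using h by simp
    have "sqrt 8 = 2 * sqrt 2" using real_sqrt_mult[of 4 2] by simp
    then have \<theta>eq: "\<theta> = 2 * sqrt 2 * sqrt D / sqrt L"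
      by (simp add: \<theta>_def real_sqrt_mult real_sqrt_divide)
    have peq: "p = (exp 1 - 1) / exp 1" by (simp add: p_def exp_minus field_simps)
    have "(exp 1 - 1)\<^sup>2 / (40 * sqrt 2 * (exp 1)\<^sup>2) * (1 / (Dn * sqrt D)) * (sqrt L / real k)
      = p\<^sup>2 / (20 * real k * \<theta> * Dn)"
      unfolding \<theta>eq peq using True D Dn k1 by (simp add: field_simps power_divide)
    also have "\<dots> \<le> h" using main \<theta> Dn k1 by (simp add: field_simps)
    finally show ?thesis .
  qed
  then show "(exp 1 - 1)\<^sup>2 / (40 * sqrt 2 * (exp 1)\<^sup>2)
        * (1 / (D_nor E w \<mu> * sqrt (D_non E w \<mu>))) * (sqrt (lambda E w \<mu> k) / real k)
      \<le> cheeger E w \<mu> 2"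
    by (simp only: Dn_def D_def L_def h_def)
qed

end
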